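(* Let $C$ be a semitopological cone, and let $\alpha$ be a continuous map from $\mathcal V_wC$ to $C$. If $\alpha(\nu)$ is the unique barycentre of $\nu$ for every $\nu\in\mathcal V_wC$, then $(C,\alpha)$ is an algebra of the monad $\mathcal V_w$ on the category $\mathbf{TOP}_0$. In that case, the cone structure on $C$ induced by the algebra $(C,\alpha)$ coincides with the original cone structure on $C$, and $C$ is a sober, weakly locally convex, topological cone.
   Context: $\mathbb R_+=[0,\infty)$ and $\overline{\mathbb R}_+=[0,\infty]$, both with the Scott topology (proper nonempty opens are the sets of elements $>r$, $r\in\mathbb R_+$). $\mathbf{TOP}_0$ is the category of $T_0$ topological spaces and continuous maps. Valuations. A continuous valuation on a space $X$ with lattice of opens $\mathcal OX$ is a map $\mu\colon\mathcal OX\to\overline{\mathbb R}_+$ with $\mu(\emptyset)=0$, $\mu(U)\le\mu(V)$ if $U\subseteq V$, $\mu(U)+\mu(V)=\mu(U\cup V)+\mu(U\cap V)$, and $\mu(\bigcup_iU_i)=\sup_i\mu(U_i)$ for directed families of opens. $\delta_x(U)=1$ if $x\in U$, and $0$ otherwise. Linear combinations of valuations are formed pointwise. $\mathcal V_wX$ is the set of all continuous valuations on $X$ with the weak topology, generated by the subbasic sets $[U>r]=\{\mu\mid\mu(U)>r\}$, $U\in\mathcal OX$, $r\in\mathbb R_+$. For continuous $h\colon X\to\overline{\mathbb R}_+$ (i.e. $h$ lower semi-continuous), $\int h\,d\mu=\int_0^\infty\mu(h^{-1}((r,\infty]))\,dr$ (Riemann integral). The monad. $\mathcal V_w$ is an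 endofunctor with $\mathcal V_wf(\mu)(V)=\mu(f^{-1}(V))$; it is a monad with unit $\eta_X(x)=\delta_x$ and multiplication $m_X(\varpi)(U)=\int_{\mu\in\mathcal V_wX}\mu(U)\,d\varpi$ for $\varpi\in\mathcal V_w\mathcal V_wX$. An algebra of $\mathcal V_w$ on $\mathbf{TOP}_0$ is a pair $(X,\alpha)$ of a $T_0$ space $X$ and a continuous map $\alpha\colon\mathcal V_wX\to X$ with $\alpha\circ\eta_X=\mathrm{id}_X$ and $\alpha\circ m_X=\alpha\circ\mathcal V_w\alpha$. The cone structure induced by the algebra is $x+y=\alpha(\delta_x+\delta_y)$, $r\cdot x=\alpha(r\delta_x)$ for $x,y\in X$, $r\in\mathbb R_+$. Cones. A cone is a commutative monoid $(C,+,0)$ with a scalar multiplication $\mathbb R_+\times C\to C$ such that $r(x+y)=rx+ry$, $(r+s)x=rx+sx$, $(rs)x=r(sx)$, $1x=x$, $0x=0$, $r0=0$. A semitopological (resp. topological) cone is a cone with a $T_0$ topology making $+$ and scalar multiplication separately (resp. jointly) continuous. A map $f$ between cones is linear if $f(rx+sy)=rf(x)+sf(y)$ for all $r,s\in\mathbb R_+$; $\overline{\mathbb R}_+$ is a cone with $0\cdot\infty=0$. A subset $A$ of a cone is convex if $ra+(1-r)b\in A$ for all $a,b\in A$, $r\in[0,1]$. A cone with a $T_0$ topology is weakly locally convex if for every point $x$, every open neighbourhood of $x$ contains a convex (not necessarily open) neighbourhood of $x$. Barycentres. For a semitopological cone $C$ and a continuous valuation $\nu$ on $C$, a barycentre of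 $\nu$ is a point $b\in C$ such that $\Lambda(b)=\int\Lambda\,d\nu$ for every linear lower semi-continuous map $\Lambda\colon C\to\overline{\mathbb R}_+$. *)

theory Defs
  imports "HOL-Analysis.Analysis"
begin

section \<open>Scott topologies on the (extended) nonnegative reals\<close>

definition scott_ennreal :: "ennreal topology" where
  "scott_ennreal =
     topology (\<lambda>U. U = {} \<or> U = UNIV \<or> (\<exists>r::real. 0 \<le> r \<and> U = {ennreal r<..}))"

text \<open>The half-line \<open>[0, \<infinity>)\<close> is the carrier \<open>{0..}\<close> inside the type \<^typ>\<open>real\<close>.\<close>

definition scott_nnreal :: "real topology" where
  "scott_nnreal =
     topology (\<lambda>U. U = {} \<or> U = {0..} \<or> (\<exists>r. 0 \<le> r \<and> U = {r<..}))"

lemma istopology_linear: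
  assumes inter: "\<And>S T. L S \<Longrightarrow> L T \<Longrightarrow> S \<subseteq> T \<or> T \<subseteq> S"
    and union: "\<And>\<K>. (\<And>K. K \<in> \<K> \<Longrightarrow> L K) \<Longrightarrow> L (\<Union>\<K>)"
  shows "istopology L"
  unfolding istopology_def
proof (intro conjI allI impI)
  fix S T assume "L S" "L T"
  with inter[of S T] show "L (S \<inter> T)" by (metis inf.absorb1 inf.absorb2)
next
  fix \<K> assume "\<forall>K\<in>\<K>. L K"
  then show "L (\<Union>\<K>)" by (intro union) auto
qed

lemma openin_scott_ennreal:
  "openin scott_ennreal U \<longleftrightarrow>
     U = {} \<or> U = UNIV \<or> (\<exists>r::real. 0 \<le> r \<and> U = {ennreal r<..})"
proof -
  let ?L = "\<lambda>U. U = {} \<or> U = UNIV \<or> (\<exists>r::real. 0 \<le> r \<and> U = {ennreal r<..})"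
  have "istopology ?L"
  proof (rule istopology_linear)
    fix S T assume "?L S" "?L T"
    moreover have "{a<..} \<subseteq> {b<..} \<or> {b<..} \<subseteq> {a<..}" for a b :: ennreal
      by (cases "a \<le> b") auto
    ultimately show "S \<subseteq> T \<or> T \<subseteq> S"
      by (elim disjE exE conjE) (simp_all add: linear)
  next
    fix \<K> assume K: "\<And>K. K \<in> \<K> \<Longrightarrow> ?L K"
    show "?L (\<Union>\<K>)"
    proof (cases "UNIV \<in> \<K> \<or> \<Union>\<K> = {}")
      case True
      then show ?thesis by auto
    next
      case False
      define R where "R = {r::ennreal. r < top \<and> {r<..} \<in> \<K>}"
      have K': "\<exists>r\<in>R. K = {r<..}" if "K \<in> \<K>" "K \<noteq> {}" for K
        using K[OF that(1)] that False unfolding R_def by auto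
      have U: "\<Union>\<K> = {Inf R<..}"
      proof (intro set_eqI iffI)
        fix x assume "x \<in> \<Union>\<K>"
        then obtain r where "r \<in> R" "x > r" using K' by blast
        then show "x \<in> {Inf R<..}" by (metis Inf_lower greaterThan_iff le_less_trans)
      next
        fix x assume "x \<in> {Inf R<..}"
        then obtain r where "r \<in> R" "x > r" by (auto simp: Inf_less_iff)
        then show "x \<in> \<Union>\<K>" unfolding R_def by auto
      qed
      have "R \<noteq> {}" using False K' by blast
      then have "Inf R < top" by (auto simp: Inf_less_iff R_def)
      then have "Inf R = ennreal (enn2real (Inf R))" by simp
      with U show ?thesis by (metis enn2real_nonneg)
    qed
  qed
  then show ?thesis
    unfolding scott_ennreal_def by (simp only: topology_inverse')
qed

lemma openin_scott_nnreal:
  "openin scott_nnreal U \<longleftrightarrow> U = {} \<or> U = {0..} \<or> (\<exists>r. 0 \<le> r \<and> U = {r<..})"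
proof -
  let ?L = "\<lambda>U::real set. U = {} \<or> U = {0..} \<or> (\<exists>r. 0 \<le> r \<and> U = {r<..})"
  have "istopology ?L"
  proof (rule istopology_linear)
    fix S T assume "?L S" "?L T"
    then show "S \<subseteq> T \<or> T \<subseteq> S" by auto
  next
    fix \<K> assume K: "\<And>K. K \<in> \<K> \<Longrightarrow> ?L K"
    show "?L (\<Union>\<K>)"
    proof (cases "{0..} \<in> \<K> \<or> \<Union>\<K> = {}")
      case True
      moreover have "\<Union>\<K> \<subseteq> {0..}" using K by fastforce
      ultimately show ?thesis by auto
    next
      case False
      define R where "R = {r::real. 0 \<le> r \<and> {r<..} \<in> \<K>}"
      have K': "\<exists>r\<in>R. K = {r<..}" if "K \<in> \<K>" "K \<noteq> {}" for K
        using K[OF that(1)] that False unfolding R_def by auto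
      have ne: "R \<noteq> {}" and bd: "bdd_below R"
        using False K' by (blast, auto simp: R_def intro: bdd_belowI[of _ 0])
      have U: "\<Union>\<K> = {Inf R<..}"
      proof (intro set_eqI iffI)
        fix x assume "x \<in> \<Union>\<K>"
        then obtain r where "r \<in> R" "x > r" using K' by blast
        then show "x \<in> {Inf R<..}" by (metis bd cInf_lower greaterThan_iff le_less_trans)
      next
        fix x assume "x \<in> {Inf R<..}"
        then obtain r where "r \<in> R" "x > r" using ne bd by (auto simp: cInf_less_iff)
        then show "x \<in> \<Union>\<K>" unfolding R_def by auto
      qed
      have "0 \<le> Inf R" using ne by (intro cInf_greatest) (auto simp: R_def)
      with U show ?thesis by blast
    qed
  qed
  then show ?thesis
    unfolding scott_nnreal_def by (simp only: topology_inverse')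
qed

lemma topspace_scott_ennreal [simp]: "topspace scott_ennreal = UNIV"
  using openin_subset[of scott_ennreal UNIV] by (auto simp: openin_scott_ennreal)

lemma topspace_scott_nnreal [simp]: "topspace scott_nnreal = {0..}"
proof
  show "topspace scott_nnreal \<subseteq> {0..}"
    unfolding topspace_def by (auto simp: openin_scott_nnreal)
  show "{0..} \<subseteq> topspace scott_nnreal"
    by (intro openin_subset) (simp add: openin_scott_nnreal)
qed


section \<open>Continuous valuations\<close>

abbreviation opens :: "'a topology \<Rightarrow> 'a set set" where
  "opens X \<equiv> Collect (openin X)"

definition directed_family :: "'a set set \<Rightarrow> bool" where
  "directed_family D \<longleftrightarrow>
     D \<noteq> {} \<and> (\<forall>U\<in>D. \<forall>V\<in>D. \<exists>W\<in>D. U \<subseteq> W \<and> V \<subseteq> W)"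

text \<open>A valuation is a map on the open sets only; it is encoded as a function on all subsets
  that is \<^const>\<open>undefined\<close> off the open sets, so that equality of valuations is equality
  of functions.\<close>

definition continuous_valuation :: "'a topology \<Rightarrow> ('a set \<Rightarrow> ennreal) \<Rightarrow> bool" where
  "continuous_valuation X \<mu> \<longleftrightarrow>
     \<mu> \<in> extensional (opens X) \<and>
     \<mu> {} = 0 \<and>
     (\<forall>U V. openin X U \<longrightarrow> openin X V \<longrightarrow> U \<subseteq> V \<longrightarrow> \<mu> U \<le> \<mu> V) \<and>
     (\<forall>U V. openin X U \<longrightarrow> openin X V \<longrightarrow> \<mu> U + \<mu> V = \<mu> (U \<union> V) + \<mu> (U \<inter> V)) \<and>
     (\<forall>D. D \<subseteq> opens X \<longrightarrow> directed_family D \<longrightarrow> \<mu> (\<Union>D) = (SUP U\<in>D. \<mu> U))"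

definition dirac :: "'a topology \<Rightarrow> 'a \<Rightarrow> 'a set \<Rightarrow> ennreal" where
  "dirac X x = (\<lambda>U\<in>opens X. if x \<in> U then 1 else 0)"

definition val_add ::
  "'a topology \<Rightarrow> ('a set \<Rightarrow> ennreal) \<Rightarrow> ('a set \<Rightarrow> ennreal) \<Rightarrow> 'a set \<Rightarrow> ennreal" where
  "val_add X \<mu> \<nu> = (\<lambda>U\<in>opens X. \<mu> U + \<nu> U)"

definition val_scale ::
  "'a topology \<Rightarrow> real \<Rightarrow> ('a set \<Rightarrow> ennreal) \<Rightarrow> 'a set \<Rightarrow> ennreal" where
  "val_scale X r \<mu> = (\<lambda>U\<in>opens X. ennreal r * \<mu> U)"

definition val_zero :: "'a topology \<Rightarrow> 'a set \<Rightarrow> ennreal" where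
  "val_zero X = (\<lambda>U\<in>opens X. 0)"

text \<open>The whole carrier is added to the subbase because the zero valuation belongs to no set
  \<open>[U > r]\<close>.\<close>

definition Vw :: "'a topology \<Rightarrow> ('a set \<Rightarrow> ennreal) topology" where
  "Vw X = topology_generated_by
     (insert {\<mu>. continuous_valuation X \<mu>}
       {{\<mu>. continuous_valuation X \<mu> \<and> ennreal r < \<mu> U} | U r. openin X U \<and> 0 \<le> r})"

lemma topspace_Vw [simp]: "topspace (Vw X) = {\<mu>. continuous_valuation X \<mu>}"
  unfolding Vw_def topology_generated_by_topspace by auto

text \<open>For continuous \<open>h\<close> the integrand is antitone in \<open>r\<close>, hence Borel measurable, and its
  Lebesgue integral over \<open>[0, \<infinity>)\<close> is its (possibly infinite) improper Riemann integral.\<close>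

definition val_integral ::
  "'a topology \<Rightarrow> ('a \<Rightarrow> ennreal) \<Rightarrow> ('a set \<Rightarrow> ennreal) \<Rightarrow> ennreal" where
  "val_integral X h \<mu> =
     (\<integral>\<^sup>+r\<in>{0..}. \<mu> {x \<in> topspace X. ennreal r < h x} \<partial>lborel)"


section \<open>The monad and its algebras\<close>

definition Vw_map ::
  "'a topology \<Rightarrow> 'b topology \<Rightarrow> ('a \<Rightarrow> 'b) \<Rightarrow> ('a set \<Rightarrow> ennreal) \<Rightarrow> 'b set \<Rightarrow> ennreal" where
  "Vw_map X Y f \<mu> = (\<lambda>V\<in>opens Y. \<mu> {x \<in> topspace X. f x \<in> V})"

definition Vw_mult ::
  "'a topology \<Rightarrow> (('a set \<Rightarrow> ennreal) set \<Rightarrow> ennreal) \<Rightarrow> 'a set \<Rightarrow> ennreal" where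
  "Vw_mult X \<omega> = (\<lambda>U\<in>opens X. val_integral (Vw X) (\<lambda>\<mu>. \<mu> U) \<omega>)"

definition Vw_algebra :: "'a topology \<Rightarrow> (('a set \<Rightarrow> ennreal) \<Rightarrow> 'a) \<Rightarrow> bool" where
  "Vw_algebra X \<alpha> \<longleftrightarrow>
     t0_space X \<and>
     continuous_map (Vw X) X \<alpha> \<and>
     (\<forall>x\<in>topspace X. \<alpha> (dirac X x) = x) \<and>
     (\<forall>\<omega>\<in>topspace (Vw (Vw X)). \<alpha> (Vw_mult X \<omega>) = \<alpha> (Vw_map (Vw X) X \<alpha> \<omega>))"

definition induced_add ::
  "'a topology \<Rightarrow> (('a set \<Rightarrow> ennreal) \<Rightarrow> 'a) \<Rightarrow> 'a \<Rightarrow> 'a \<Rightarrow> 'a" where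
  "induced_add X \<alpha> x y = \<alpha> (val_add X (dirac X x) (dirac X y))"

definition induced_scale ::
  "'a topology \<Rightarrow> (('a set \<Rightarrow> ennreal) \<Rightarrow> 'a) \<Rightarrow> real \<Rightarrow> 'a \<Rightarrow> 'a" where
  "induced_scale X \<alpha> r x = \<alpha> (val_scale X r (dirac X x))"

text \<open>The zero of the induced cone is \<open>0 \<cdot> x = \<alpha> (0 \<delta>\<^sub>x)\<close>, and \<open>0 \<delta>\<^sub>x\<close> is the zero valuation.\<close>

definition induced_zero :: "'a topology \<Rightarrow> (('a set \<Rightarrow> ennreal) \<Rightarrow> 'a) \<Rightarrow> 'a" where
  "induced_zero X \<alpha> = \<alpha> (val_zero X)"


section \<open>Cones\<close>

text \<open>Scalars are reals; nothing is required of \<open>scal r\<close> for negative \<open>r\<close>.\<close>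

locale cone_on =
  fixes C :: "'a set"
    and add :: "'a \<Rightarrow> 'a \<Rightarrow> 'a"
    and zero :: 'a
    and scal :: "real \<Rightarrow> 'a \<Rightarrow> 'a"
  assumes add_closed: "x \<in> C \<Longrightarrow> y \<in> C \<Longrightarrow> add x y \<in> C"
    and zero_closed: "zero \<in> C"
    and scale_closed: "0 \<le> r \<Longrightarrow> x \<in> C \<Longrightarrow> scal r x \<in> C"
    and add_assoc: "x \<in> C \<Longrightarrow> y \<in> C \<Longrightarrow> z \<in> C \<Longrightarrow> add (add x y) z = add x (add y z)"
    and add_comm: "x \<in> C \<Longrightarrow> y \<in> C \<Longrightarrow> add x y = add y x"
    and add_zero: "x \<in> C \<Longrightarrow> add zero x = x"
    and scale_add: "0 \<le> r \<Longrightarrow> x \<in> C \<Longrightarrow> y \<in> C \<Longrightarrow>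
      scal r (add x y) = add (scal r x) (scal r y)"
    and add_scale: "0 \<le> r \<Longrightarrow> 0 \<le> s \<Longrightarrow> x \<in> C \<Longrightarrow>
      scal (r + s) x = add (scal r x) (scal s x)"
    and scale_scale: "0 \<le> r \<Longrightarrow> 0 \<le> s \<Longrightarrow> x \<in> C \<Longrightarrow> scal (r * s) x = scal r (scal s x)"
    and one_scale: "x \<in> C \<Longrightarrow> scal 1 x = x"
    and zero_scale: "x \<in> C \<Longrightarrow> scal 0 x = zero"
    and scale_zero: "0 \<le> r \<Longrightarrow> scal r zero = zero"

locale semitopological_cone = cone_on "topspace X" add zero scal
  for X :: "'a topology" and add zero scal +
  assumes t0: "t0_space X"
    and add_separately: "x \<in> topspace X \<Longrightarrow> continuous_map X X (add x)"
      "y \<in> topspace X \<Longrightarrow> continuous_map X X (\<lambda>x. add x y)"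
    and scale_separately: "0 \<le> r \<Longrightarrow> continuous_map X X (scal r)"
      "x \<in> topspace X \<Longrightarrow> continuous_map scott_nnreal X (\<lambda>r. scal r x)"

locale topological_cone = cone_on "topspace X" add zero scal
  for X :: "'a topology" and add zero scal +
  assumes t0: "t0_space X"
    and add_jointly: "continuous_map (prod_topology X X) X (\<lambda>(x, y). add x y)"
    and scale_jointly: "continuous_map (prod_topology scott_nnreal X) X (\<lambda>(r, x). scal r x)"

definition cone_convex ::
  "('a \<Rightarrow> 'a \<Rightarrow> 'a) \<Rightarrow> (real \<Rightarrow> 'a \<Rightarrow> 'a) \<Rightarrow> 'a set \<Rightarrow> bool" where
  "cone_convex add scal A \<longleftrightarrow>
     (\<forall>a\<in>A. \<forall>b\<in>A. \<forall>r\<in>{0..1}. add (scal r a) (scal (1 - r) b) \<in> A)"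

definition weakly_locally_convex ::
  "'a topology \<Rightarrow> ('a \<Rightarrow> 'a \<Rightarrow> 'a) \<Rightarrow> (real \<Rightarrow> 'a \<Rightarrow> 'a) \<Rightarrow> bool" where
  "weakly_locally_convex X add scal \<longleftrightarrow>
     (\<forall>x U. openin X U \<longrightarrow> x \<in> U \<longrightarrow>
        (\<exists>A. cone_convex add scal A \<and> A \<subseteq> U \<and> x \<in> X interior_of A))"

text \<open>Linear maps into the cone \<open>[0, \<infinity>]\<close>; in \<^typ>\<open>ennreal\<close> one has \<open>0 * \<infinity> = 0\<close>.\<close>

definition linear_functional_on ::
  "'a set \<Rightarrow> ('a \<Rightarrow> 'a \<Rightarrow> 'a) \<Rightarrow> (real \<Rightarrow> 'a \<Rightarrow> 'a) \<Rightarrow> ('a \<Rightarrow> ennreal) \<Rightarrow> bool" where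
  "linear_functional_on C add scal \<Lambda> \<longleftrightarrow>
     (\<forall>r\<ge>0. \<forall>s\<ge>0. \<forall>x\<in>C. \<forall>y\<in>C.
        \<Lambda> (add (scal r x) (scal s y)) = ennreal r * \<Lambda> x + ennreal s * \<Lambda> y)"

definition barycentre ::
  "'a topology \<Rightarrow> ('a \<Rightarrow> 'a \<Rightarrow> 'a) \<Rightarrow> (real \<Rightarrow> 'a \<Rightarrow> 'a) \<Rightarrow> ('a set \<Rightarrow> ennreal) \<Rightarrow> 'a \<Rightarrow> bool" where
  "barycentre X add scal \<nu> b \<longleftrightarrow>
     b \<in> topspace X \<and>
     (\<forall>\<Lambda>. linear_functional_on (topspace X) add scal \<Lambda> \<longrightarrow>
          continuous_map X scott_ennreal \<Lambda> \<longrightarrow>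
          \<Lambda> b = val_integral X \<Lambda> \<nu>)"


section \<open>Sobriety\<close>

definition irreducible_closedin :: "'a topology \<Rightarrow> 'a set \<Rightarrow> bool" where
  "irreducible_closedin X F \<longleftrightarrow>
     closedin X F \<and> F \<noteq> {} \<and>
     (\<forall>A B. closedin X A \<longrightarrow> closedin X B \<longrightarrow> F \<subseteq> A \<union> B \<longrightarrow> F \<subseteq> A \<or> F \<subseteq> B)"

definition sober_space :: "'a topology \<Rightarrow> bool" where
  "sober_space X \<longleftrightarrow>
     (\<forall>F. irreducible_closedin X F \<longrightarrow> (\<exists>!x. x \<in> topspace X \<and> F = X closure_of {x}))"

end

theory Submission
  imports Defs
begin

text \<open>
  The point \<open>\<alpha>(\<nu>)\<close> is determined by \<open>\<Lambda>(\<alpha>(\<nu>)) = \<integral> \<Lambda> d\<nu>\<close> for linear \<open>\<Lambda>\<close>,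
  so each algebraic identity is proved by exhibiting the claimed value as a
  barycentre and appealing to uniqueness. The identity \<open>\<alpha> \<circ> m = \<alpha> \<circ> V\<^sub>w \<alpha>\<close> needs
  \<open>\<integral> h dm(\<omega>) = \<integral> (\<integral> h d\<mu>) d\<omega>(\<mu>)\<close>: integrals are suprema of dyadic lower sums, and integration against
  a continuous valuation is linear and commutes with directed suprema.

  The topological claims use only that \<open>\<alpha>\<close> is a continuous linear retraction of \<open>x \<mapsto> \<delta>\<^sub>x\<close>.
  An irreducible closed set \<open>F\<close> gives the two-valued valuation \<open>U \<mapsto> [U meets F]\<close>, which \<open>\<alpha>\<close> sends to
  the generic point of \<open>F\<close>. The image under \<open>\<alpha>\<close> of a basic weak neighbourhood of \<open>\<delta>\<^sub>x\<close> is a convex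
  neighbourhood of \<open>x\<close>. Joint continuity holds because \<open>(x, y) \<mapsto> \<delta>\<^sub>x + \<delta>\<^sub>y\<close> and \<open>(r, x) \<mapsto> r \<delta>\<^sub>x\<close> are
  jointly continuous.
\<close>

section \<open>Dyadic lower sums\<close>

text \<open>Superlevel sets of an antitone function are intervals, hence Borel.\<close>

lemma borel_measurable_antimono_ennreal:
  fixes f :: "real \<Rightarrow> ennreal"
  assumes "antimono f"
  shows "f \<in> borel_measurable borel"
proof (rule borel_measurableI_greater)
  fix c
  have "is_interval {x. c < f x}"
    unfolding is_interval_1 using antimonoD[OF assms] by (auto intro: less_le_trans)
  then show "{x \<in> space borel. c < f x} \<in> sets borel"
    by (simp add: real_interval_borel_measurable)
qed

text \<open>The Riemann lower sum from 0 to \<open>n\<close> with mesh \<open>1 / 2 ^ n\<close>: an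
  antitone \<open>f\<close> is least at the right endpoint of each cell. Letting \<open>n\<close>
  govern both range and mesh leaves a single increasing sequence.\<close>

definition lower_sum :: "nat \<Rightarrow> (real \<Rightarrow> ennreal) \<Rightarrow> ennreal" where
  "lower_sum n f = (\<Sum>k<n * 2 ^ n. ennreal (1 / 2 ^ n) * f (real (Suc k) / 2 ^ n))"

definition lower_step :: "nat \<Rightarrow> (real \<Rightarrow> ennreal) \<Rightarrow> real \<Rightarrow> ennreal" where
  "lower_step n f r =
     (\<Sum>k<n * 2 ^ n. f (real (Suc k) / 2 ^ n) * indicator {real k / 2 ^ n..<real (Suc k) / 2 ^ n} r)"

lemma borel_measurable_lower_step [measurable]: "lower_step n f \<in> borel_measurable borel"
  unfolding lower_step_def[abs_def] by measurable

lemma nn_integral_lower_step: "(\<integral>\<^sup>+r. lower_step n f r \<partial>lborel) = lower_sum n f"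
proof -
  have "(\<integral>\<^sup>+r. lower_step n f r \<partial>lborel) = (\<Sum>k<n * 2 ^ n. f (real (Suc k) / 2 ^ n) *
      emeasure lborel {real k / 2 ^ n..<real (Suc k) / 2 ^ n})"
    unfolding lower_step_def by (subst nn_integral_sum) (simp_all add: nn_integral_cmult)
  also have "\<dots> = lower_sum n f"
    unfolding lower_sum_def
    by (intro sum.cong refl) (simp add: divide_right_mono diff_divide_distrib[symmetric] mult.commute)
  finally show ?thesis .
qed

text \<open>The only dyadic cell that can contain \<open>r\<close> has index
  \<open>\<lfloor>2 ^ n * r\<rfloor>\<close>, so at most one summand survives. The half-open cells
  fill exactly \<open>{0..<n}\<close>, and the \<open>+ 1\<close> selects the right
  endpoint.\<close>

lemma lower_step_eq:
  "lower_step n f r =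
     (if 0 \<le> r \<and> r < real n then f (real_of_int (\<lfloor>2 ^ n * r\<rfloor> + 1) / 2 ^ n) else 0)"
proof -
  have mem: "r \<in> {real k / 2 ^ n..<real (Suc k) / 2 ^ n} \<longleftrightarrow> \<lfloor>2 ^ n * r\<rfloor> = int k" for k
  proof -
    have "r \<in> {real k / 2 ^ n..<real (Suc k) / 2 ^ n} \<longleftrightarrow> real k \<le> 2 ^ n * r \<and> 2 ^ n * r < real k + 1"
      by (auto simp: field_simps)
    then show ?thesis by (simp add: floor_eq_iff)
  qed
  have step: "lower_step n f r =
      (\<Sum>k<n * 2 ^ n. f (real (Suc k) / 2 ^ n) * (if \<lfloor>2 ^ n * r\<rfloor> = int k then 1 else 0))"
    unfolding lower_step_def indicator_def mem of_bool_def ..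
  have range: "0 \<le> r \<and> r < real n \<longleftrightarrow> 0 \<le> \<lfloor>2 ^ n * r\<rfloor> \<and> \<lfloor>2 ^ n * r\<rfloor> < int (n * 2 ^ n)"
  proof -
    have "\<not> (2::real) ^ n \<le> 0" by (simp add: not_le)
    then show ?thesis by (simp add: floor_less_iff zero_le_mult_iff mult.commute)
  qed
  show ?thesis
  proof (cases "0 \<le> r \<and> r < real n")
    case True
    then obtain k where k: "\<lfloor>2 ^ n * r\<rfloor> = int k" "k < n * 2 ^ n"
      using range by (metis nonneg_int_cases of_nat_less_iff)
    then have "lower_step n f r = (\<Sum>j<n * 2 ^ n. if j = k then f (real (Suc k) / 2 ^ n) else 0)"
      unfolding step by (intro sum.cong) auto
    with k True show ?thesis by (simp add: add.commute)
  next
    case False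
    have "\<lfloor>2 ^ n * r\<rfloor> \<noteq> int k" if "k < n * 2 ^ n" for k
      using False that unfolding range by (metis of_nat_0_le_iff of_nat_less_iff)
    then show ?thesis using False unfolding step by (auto intro!: sum.neutral)
  qed
qed

text \<open>The grid of mesh \<open>1 / 2 ^ n\<close> is contained in the next finer one, so the
  first grid point beyond \<open>r\<close> never moves right under refinement, and an antitone
  \<open>f\<close> sampled there never decreases.\<close>

lemma dyadic_next_antimono:
  fixes r :: real
  shows "real_of_int (\<lfloor>2 ^ Suc n * r\<rfloor> + 1) / 2 ^ Suc n \<le> real_of_int (\<lfloor>2 ^ n * r\<rfloor> + 1) / 2 ^ n"
proof -
  have "2 ^ n * r < real_of_int (\<lfloor>2 ^ n * r\<rfloor> + 1)" by linarith
  then have "2 * (2 ^ n * r) < 2 * real_of_int (\<lfloor>2 ^ n * r\<rfloor> + 1)"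
    by (rule mult_strict_left_mono) simp
  then have "2 ^ Suc n * r < real_of_int (2 * (\<lfloor>2 ^ n * r\<rfloor> + 1))"
    by (simp only: power_Suc of_int_mult of_int_numeral mult.assoc)
  then have "\<lfloor>2 ^ Suc n * r\<rfloor> < 2 * (\<lfloor>2 ^ n * r\<rfloor> + 1)" by (simp only: floor_less_iff)
  then have "\<lfloor>2 ^ Suc n * r\<rfloor> + 1 \<le> 2 * (\<lfloor>2 ^ n * r\<rfloor> + 1)" by simp
  then have "real_of_int (\<lfloor>2 ^ Suc n * r\<rfloor> + 1) \<le> 2 * real_of_int (\<lfloor>2 ^ n * r\<rfloor> + 1)"
    by (metis of_int_le_iff of_int_mult of_int_numeral)
  then have "real_of_int (\<lfloor>2 ^ Suc n * r\<rfloor> + 1) / 2 ^ Suc n \<le>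
      2 * real_of_int (\<lfloor>2 ^ n * r\<rfloor> + 1) / 2 ^ Suc n"
    by (intro divide_right_mono) auto
  moreover have "2 * x / 2 ^ Suc n = x / 2 ^ n" for x :: real by simp
  ultimately show ?thesis by (simp only:)
qed

lemma incseq_lower_step:
  assumes "antimono f"
  shows "incseq (\<lambda>n. lower_step n f)"
  by (intro incseq_SucI le_funI)
     (use dyadic_next_antimono antimonoD[OF assms] in \<open>auto simp: lower_step_eq\<close>)

lemma incseq_lower_sum:
  assumes "antimono f"
  shows "incseq (\<lambda>n. lower_sum n f)"
  using incseq_lower_step[OF assms] unfolding nn_integral_lower_step[symmetric] incseq_def le_fun_def
  by (auto intro: nn_integral_mono)

text \<open>The sample points approach \<open>r\<close> strictly from the right, so their values
  have the supremum of \<open>f\<close> over \<open>{r<..}\<close>; right-continuity, in the form of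
  \<open>right\<close>, identifies it with \<open>f r\<close>.\<close>

lemma SUP_lower_step:
  fixes f :: "real \<Rightarrow> ennreal"
  assumes f: "antimono f" and right: "f r \<le> (SUP s\<in>{r<..}. f s)" and "0 \<le> r"
  shows "(SUP n. lower_step n f r) = f r"
proof (rule antisym)
  have "r \<le> real_of_int (\<lfloor>2 ^ n * r\<rfloor> + 1) / 2 ^ n" for n
  proof -
    have "2 ^ n * r \<le> real_of_int (\<lfloor>2 ^ n * r\<rfloor> + 1)" by linarith
    then show ?thesis by (simp add: field_simps)
  qed
  then show "(SUP n. lower_step n f r) \<le> f r"
    using antimonoD[OF f] by (intro SUP_least) (simp add: lower_step_eq)
  have "f s \<le> (SUP n. lower_step n f r)" if "r < s" for s
  proof -
    obtain m where m: "r < real m" using reals_Archimedean2 by blast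
    obtain l where l: "inverse (2 ^ l) < s - r"
      using real_arch_pow_inv[of "s - r" "1/2"] \<open>r < s\<close> by (auto simp: power_divide inverse_eq_divide)
    \<comment> \<open>\<open>m\<close> brings \<open>r\<close> into the range of the step function,
      and \<open>l\<close> makes the mesh smaller than \<open>s - r\<close>.\<close>
    define n where "n = max l m"
    have "inverse (2 ^ n) \<le> inverse (2 ^ l :: real)" by (simp add: n_def)
    moreover have "real_of_int (\<lfloor>2 ^ n * r\<rfloor> + 1) / 2 ^ n \<le> (2 ^ n * r + 1) / 2 ^ n"
      by (intro divide_right_mono) auto
    moreover have "(2 ^ n * r + 1) / 2 ^ n = r + inverse (2 ^ n)" by (simp add: field_simps)
    ultimately have "real_of_int (\<lfloor>2 ^ n * r\<rfloor> + 1) / 2 ^ n \<le> s" using l by linarith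
    then have "f s \<le> lower_step n f r"
      using m \<open>0 \<le> r\<close> antimonoD[OF f] by (auto simp: lower_step_eq n_def)
    then show ?thesis by (rule SUP_upper2[OF UNIV_I])
  qed
  then show "f r \<le> (SUP n. lower_step n f r)"
    by (intro order.trans[OF right] SUP_least) auto
qed

lemma nn_integral_eq_SUP_lower_sum:
  fixes f :: "real \<Rightarrow> ennreal"
  assumes f: "antimono f" and right: "\<And>r. 0 \<le> r \<Longrightarrow> f r \<le> (SUP s\<in>{r<..}. f s)"
  shows "(\<integral>\<^sup>+r\<in>{0..}. f r \<partial>lborel) = (SUP n. lower_sum n f)"
proof -
  have "(\<integral>\<^sup>+r\<in>{0..}. f r \<partial>lborel) = (\<integral>\<^sup>+r. (SUP n. lower_step n f r) \<partial>lborel)"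
  proof (intro nn_integral_cong)
    fix r show "f r * indicator {0..} r = (SUP n. lower_step n f r)"
      by (cases "0 \<le> r") (simp_all add: SUP_lower_step[OF f right], simp add: lower_step_eq)
  qed
  also have "\<dots> = (SUP n. lower_sum n f)"
    by (simp add: nn_integral_monotone_convergence_SUP incseq_lower_step[OF f] nn_integral_lower_step)
  finally show ?thesis .
qed

text \<open>A lower sum is a finite sum, and finite sums commute with directed suprema because one
  index dominates any two.\<close>

lemma lower_sum_SUP_directed:
  assumes directed: "\<And>i j. i \<in> I \<Longrightarrow> j \<in> I \<Longrightarrow> \<exists>k\<in>I. \<forall>r. f i r \<le> f k r \<and> f j r \<le> f k r"
    and "I \<noteq> {}"
  shows "lower_sum n (\<lambda>r. SUP i\<in>I. f i r) = (SUP i\<in>I. lower_sum n (f i))"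
proof -
  \<comment> \<open>Arbitrary finite \<open>K\<close> and sample points \<open>t\<close> make the
    claim fit for induction; the dyadic case is an instance.\<close>
  have "(\<Sum>k\<in>K. c * (SUP i\<in>I. f i (t k))) = (SUP i\<in>I. \<Sum>k\<in>K. c * f i (t k))"
    if "finite K" for K :: "nat set" and c t
    using that
  proof induction
    case empty
    then show ?case using \<open>I \<noteq> {}\<close> by simp
  next
    case (insert m K)
    have "(SUP i\<in>I. c * f i (t m) + (\<Sum>k\<in>K. c * f i (t k))) =
      (SUP i\<in>I. c * f i (t m)) + (SUP i\<in>I. \<Sum>k\<in>K. c * f i (t k))"
    proof (rule SUP_add_directed_ennreal)
      fix i j assume "i \<in> I" "j \<in> I"
      then obtain k where "k \<in> I" and k: "\<And>r. f i r \<le> f k r \<and> f j r \<le> f k r"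
        using directed by blast
      show "\<exists>k\<in>I. c * f i (t m) + (\<Sum>l\<in>K. c * f j (t l)) \<le> c * f k (t m) + (\<Sum>l\<in>K. c * f k (t l))"
        using k by (intro bexI[OF _ \<open>k \<in> I\<close>] add_mono sum_mono mult_left_mono) auto
    qed
    with insert show ?case by (simp add: SUP_mult_left_ennreal)
  qed
  then show ?thesis unfolding lower_sum_def by simp
qed

section \<open>Integration against a continuous valuation\<close>

abbreviation lsc :: "'a topology \<Rightarrow> ('a \<Rightarrow> ennreal) \<Rightarrow> bool" where
  "lsc X h \<equiv> continuous_map X scott_ennreal h"

definition level :: "'a topology \<Rightarrow> ('a \<Rightarrow> ennreal) \<Rightarrow> real \<Rightarrow> 'a set" where
  "level X h r = {x \<in> topspace X. ennreal r < h x}"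

lemma lsc_iff: "lsc X h \<longleftrightarrow> (\<forall>r\<ge>0. openin X (level X h r))"
proof
  assume h: "lsc X h"
  show "\<forall>r\<ge>0. openin X (level X h r)"
  proof (intro allI impI)
    fix r :: real assume "0 \<le> r"
    then have "openin scott_ennreal {ennreal r<..}" by (auto simp: openin_scott_ennreal)
    from openin_continuous_map_preimage[OF h this] show "openin X (level X h r)"
      by (simp add: level_def)
  qed
next
  assume "\<forall>r\<ge>0. openin X (level X h r)"
  then show "lsc X h"
    by (auto simp: continuous_map_def level_def openin_scott_ennreal)
qed

text \<open>For negative \<open>r\<close> the value \<open>ennreal r\<close> is 0, so the level set
  is the one at 0.\<close>

lemma openin_level: "lsc X h \<Longrightarrow> openin X (level X h r)"
  by (cases "0 \<le> r") (use lsc_iff[of X h] in \<open>auto simp: level_def ennreal_neg dest: spec[of _ 0]\<close>)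

lemma lsc_cong: "(\<And>x. x \<in> topspace X \<Longrightarrow> h x = g x) \<Longrightarrow> lsc X h \<longleftrightarrow> lsc X g"
  by (rule iffI; erule continuous_map_eq) auto

lemma lsc_SUP:
  assumes "\<And>i. i \<in> I \<Longrightarrow> lsc X (h i)"
  shows "lsc X (\<lambda>x. SUP i\<in>I. h i x)"
proof -
  have "level X (\<lambda>x. SUP i\<in>I. h i x) r = (\<Union>i\<in>I. level X (h i) r)" for r
    by (auto simp: level_def less_SUP_iff)
  then show ?thesis using assms by (auto simp: lsc_iff)
qed

lemma level_add_indicator_less:
  assumes "0 \<le> r" "r < a" "U \<subseteq> topspace X"
  shows "level X (\<lambda>x. h x + ennreal a * indicator U x) r = level X h r \<union> U"
proof -
  have "ennreal r < ennreal a" using assms by (simp add: ennreal_less_iff)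
  then have "ennreal r < h x + ennreal a" for x by (simp add: add_increasing less_le_trans)
  then show ?thesis using assms by (auto simp: level_def indicator_def)
qed

text \<open>At heights \<open>r\<close> at least \<open>a\<close>, a point of \<open>U\<close>
  qualifies when \<open>h\<close> exceeds \<open>r - a\<close>; a point outside \<open>U\<close>
  must have \<open>h\<close> above \<open>r\<close>.\<close>

lemma level_add_indicator_ge:
  assumes "0 \<le> a" "a \<le> r" "U \<subseteq> topspace X"
  shows "level X (\<lambda>x. h x + ennreal a * indicator U x) r = level X h r \<union> (U \<inter> level X h (r - a))"
proof -
  have r: "ennreal r = ennreal a + ennreal (r - a)"
    using assms by (simp flip: ennreal_plus)
  have "ennreal (r - a) < h x \<longleftrightarrow> ennreal r < h x + ennreal a" for x
    unfolding r by (subst (2) add.commute) (simp add: ennreal_add_left_cancel_less)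
  moreover have "ennreal (r - a) < y" if "ennreal r < y" for y
    using that ennreal_leI[of "r - a" r] assms(1) by (simp add: le_less_trans)
  ultimately show ?thesis using assms by (auto simp: level_def indicator_def)
qed

lemma lsc_add_indicator:
  assumes "lsc X h" "openin X U" "0 \<le> a"
  shows "lsc X (\<lambda>x. h x + ennreal a * indicator U x)"
proof -
  have "openin X (level X (\<lambda>x. h x + ennreal a * indicator U x) r)" if "0 \<le> r" for r
    using assms that openin_subset[OF assms(2)]
    by (cases "r < a")
       (auto simp: level_add_indicator_less level_add_indicator_ge intro!: openin_level openin_Int openin_Un)
  then show ?thesis by (simp add: lsc_iff)
qed

context
  fixes X :: "'a topology" and \<mu>
  assumes val: "continuous_valuation X \<mu>"
begin

lemma valuation_empty: "\<mu> {} = 0"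
  using val by (simp add: continuous_valuation_def)

lemma valuation_mono: "openin X U \<Longrightarrow> openin X V \<Longrightarrow> U \<subseteq> V \<Longrightarrow> \<mu> U \<le> \<mu> V"
  using val by (simp add: continuous_valuation_def)

lemma valuation_modular:
  "openin X U \<Longrightarrow> openin X V \<Longrightarrow> \<mu> U + \<mu> V = \<mu> (U \<union> V) + \<mu> (U \<inter> V)"
  using val by (simp add: continuous_valuation_def)

lemma valuation_Union_directed:
  "D \<subseteq> opens X \<Longrightarrow> directed_family D \<Longrightarrow> \<mu> (\<Union>D) = (SUP U\<in>D. \<mu> U)"
  using val by (simp add: continuous_valuation_def)

lemma valuation_UN_directed:
  assumes "I \<noteq> {}" "\<And>i. i \<in> I \<Longrightarrow> openin X (U i)"
    and "\<And>i j. i \<in> I \<Longrightarrow> j \<in> I \<Longrightarrow> \<exists>k\<in>I. U i \<subseteq> U k \<and> U j \<subseteq> U k"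
  shows "\<mu> (\<Union>i\<in>I. U i) = (SUP i\<in>I. \<mu> (U i))"
proof -
  have "\<mu> (\<Union>(U ` I)) = (SUP V\<in>U ` I. \<mu> V)"
    using assms by (intro valuation_Union_directed) (auto simp: directed_family_def)
  then show ?thesis by (simp add: image_image)
qed

section \<open>Level sets under a valuation, and directed suprema of integrands\<close>

lemma level_antimono: "antimono (level X h)"
  by (auto simp: antimono_def level_def dest: ennreal_leI intro: le_less_trans)

lemma antimono_valuation_level: "lsc X h \<Longrightarrow> antimono (\<lambda>r. \<mu> (level X h r))"
  using level_antimono[of h] by (auto simp: antimono_def intro!: valuation_mono openin_level)

text \<open>\<open>{h > r}\<close> is the directed union of the sets \<open>{h > s}\<close> with
  \<open>s > r\<close>, so continuity of the valuation gives the right-continuity that convergence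
  of the lower sums requires.\<close>

lemma valuation_level_right:
  assumes "lsc X h" "0 \<le> r"
  shows "\<mu> (level X h r) \<le> (SUP s\<in>{r<..}. \<mu> (level X h s))"
proof -
  have "level X h r \<subseteq> (\<Union>s\<in>{r<..}. level X h s)"
  proof
    fix x assume "x \<in> level X h r"
    then have x: "x \<in> topspace X" "ennreal r < h x" by (auto simp: level_def)
    then obtain z where z: "ennreal r < z" "z < h x" using dense by blast
    \<comment> \<open>\<open>z\<close> is finite because it lies strictly below \<open>h x\<close>,
      so it is a real level.\<close>
    then have "z = ennreal (enn2real z)" by (metis ennreal_enn2real order_less_le_trans top_greatest)
    moreover from this have "r < enn2real z" using z(1) \<open>0 \<le> r\<close> by (metis ennreal_less_iff)
    ultimately show "x \<in> (\<Union>s\<in>{r<..}. level X h s)"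
      using z x by (auto simp: level_def intro!: bexI[of _ "enn2real z"])
  qed
  then have "\<mu> (level X h r) \<le> \<mu> (\<Union>s\<in>{r<..}. level X h s)"
    using assms by (intro valuation_mono) (auto intro: openin_level)
  also have "\<dots> = (SUP s\<in>{r<..}. \<mu> (level X h s))"
  proof (rule valuation_UN_directed)
    show "{r<..} \<noteq> {}" by simp
  next
    fix s t assume st: "s \<in> {r<..}" "t \<in> {r<..}"
    show "\<exists>u\<in>{r<..}. level X h s \<subseteq> level X h u \<and> level X h t \<subseteq> level X h u"
      using st by (intro bexI[of _ "min s t"]) (auto intro!: antimonoD[OF level_antimono])
  qed (use assms in \<open>auto intro: openin_level\<close>)
  finally show ?thesis .
qed

lemma val_integral_eq_SUP_lower_sum:
  "lsc X h \<Longrightarrow> val_integral X h \<mu> = (SUP n. lower_sum n (\<lambda>r. \<mu> (level X h r)))"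
  unfolding val_integral_def level_def[symmetric]
  by (intro nn_integral_eq_SUP_lower_sum antimono_valuation_level valuation_level_right)

lemma val_integral_cong:
  "(\<And>x. x \<in> topspace X \<Longrightarrow> h x = g x) \<Longrightarrow> val_integral X h \<mu> = val_integral X g \<mu>"
  unfolding val_integral_def by (metis (mono_tags, lifting) Collect_cong)

lemma val_integral_mono:
  assumes "lsc X h" "lsc X g" "\<And>x. x \<in> topspace X \<Longrightarrow> h x \<le> g x"
  shows "val_integral X h \<mu> \<le> val_integral X g \<mu>"
  unfolding val_integral_def level_def[symmetric]
  using assms
  by (intro nn_integral_mono mult_right_mono valuation_mono openin_level)
     (auto simp: level_def intro: less_le_trans)

text \<open>The level sets of a directed supremum are directed unions of level sets. Continuity of
  the valuation and of each lower sum moves the supremum outwards, and two suprema are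
  exchanged.\<close>

lemma val_integral_SUP_directed:
  assumes "I \<noteq> {}" and h: "\<And>i. i \<in> I \<Longrightarrow> lsc X (h i)"
    and directed: "\<And>i j. i \<in> I \<Longrightarrow> j \<in> I \<Longrightarrow>
      \<exists>k\<in>I. \<forall>x\<in>topspace X. h i x \<le> h k x \<and> h j x \<le> h k x"
  shows "val_integral X (\<lambda>x. SUP i\<in>I. h i x) \<mu> = (SUP i\<in>I. val_integral X (h i) \<mu>)"
proof -
  have dir: "\<exists>k\<in>I. \<forall>r. level X (h i) r \<subseteq> level X (h k) r \<and> level X (h j) r \<subseteq> level X (h k) r"
    if ij: "i \<in> I" "j \<in> I" for i j
  proof -
    obtain k where "k \<in> I" "\<forall>x\<in>topspace X. h i x \<le> h k x \<and> h j x \<le> h k x"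
      using directed[OF ij] by blast
    then show ?thesis by (intro bexI[of _ k]) (auto simp: level_def intro: less_le_trans)
  qed
  have "\<mu> (level X (\<lambda>x. SUP i\<in>I. h i x) r) = (SUP i\<in>I. \<mu> (level X (h i) r))" for r
  proof -
    have "level X (\<lambda>x. SUP i\<in>I. h i x) r = (\<Union>i\<in>I. level X (h i) r)"
      by (auto simp: level_def less_SUP_iff)
    then show ?thesis using assms(1) h dir
      by (simp, intro valuation_UN_directed) (auto intro: openin_level, meson)
  qed
  then have "val_integral X (\<lambda>x. SUP i\<in>I. h i x) \<mu> =
      (SUP n. lower_sum n (\<lambda>r. SUP i\<in>I. \<mu> (level X (h i) r)))"
    using h by (simp add: val_integral_eq_SUP_lower_sum lsc_SUP)
  also have "\<dots> = (SUP n. SUP i\<in>I. lower_sum n (\<lambda>r. \<mu> (level X (h i) r)))"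
  proof (subst lower_sum_SUP_directed)
    fix i j assume ij: "i \<in> I" "j \<in> I"
    then obtain k where "k \<in> I" "\<forall>r. level X (h i) r \<subseteq> level X (h k) r \<and> level X (h j) r \<subseteq> level X (h k) r"
      using dir by blast
    then show "\<exists>k\<in>I. \<forall>r. \<mu> (level X (h i) r) \<le> \<mu> (level X (h k) r) \<and>
        \<mu> (level X (h j) r) \<le> \<mu> (level X (h k) r)"
      using ij h by (intro bexI[of _ k]) (auto intro!: valuation_mono openin_level)
  qed (use assms(1) in auto)
  also have "\<dots> = (SUP i\<in>I. SUP n. lower_sum n (\<lambda>r. \<mu> (level X (h i) r)))"
    by (rule SUP_commute)
  also have "\<dots> = (SUP i\<in>I. val_integral X (h i) \<mu>)"
    using h by (simp add: val_integral_eq_SUP_lower_sum)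
  finally show ?thesis .
qed

text \<open>Modularity applied to \<open>{h > r}\<close> and \<open>U \<inter> {h > r - a}\<close> yields the claim up to adding
  \<open>J = \<integral> \<mu> (U \<inter> {h > r}) dr\<close> on both sides. \<open>J\<close> cancels when it is finite; otherwise both sides are
  infinite, since \<open>J \<le> \<integral> h d\<mu>\<close>.\<close>

lemma val_integral_add_indicator:
  assumes h: "lsc X h" and U: "openin X U" and a: "0 \<le> a"
  shows "val_integral X (\<lambda>x. h x + ennreal a * indicator U x) \<mu> = val_integral X h \<mu> + ennreal a * \<mu> U"
proof -
  let ?k = "\<lambda>x. h x + ennreal a * indicator U x"
  define H where "H r = \<mu> (level X h r)" for r
  define K where "K r = \<mu> (level X ?k r)" for r
  define J where "J r = \<mu> (U \<inter> level X h r)" for r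
  have op: "openin X (U \<inter> level X h r)" for r using U h by (intro openin_Int openin_level)
  have [measurable]: "H \<in> borel_measurable borel" "K \<in> borel_measurable borel"
    unfolding H_def[abs_def] K_def[abs_def]
    by (intro borel_measurable_antimono_ennreal antimono_valuation_level lsc_add_indicator h U a)+
  have [measurable]: "J \<in> borel_measurable borel"
    unfolding J_def[abs_def] using level_antimono[of h]
    by (intro borel_measurable_antimono_ennreal)
       (auto simp: antimono_def intro!: valuation_mono op dest: subsetD)
  \<comment> \<open>Below \<open>a\<close> all of \<open>U\<close> joins \<open>{h > r}\<close>;
    from \<open>a\<close> on only \<open>U \<inter> {h > r - a}\<close> does. In both cases the
    overlap with \<open>{h > r}\<close> is \<open>U \<inter> {h > r}\<close>, whose mass is
    \<open>J r\<close>.\<close>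
  have pointwise: "K r + J r = H r + (if r < a then \<mu> U else J (r - a))" if "0 \<le> r" for r
  proof (cases "r < a")
    case True
    have "level X ?k r = level X h r \<union> U"
      using True that openin_subset[OF U] by (intro level_add_indicator_less)
    then show ?thesis
      using True valuation_modular[OF openin_level[OF h] U, of r]
      by (simp add: H_def K_def J_def Int_commute)
  next
    case False
    have "level X ?k r = level X h r \<union> (U \<inter> level X h (r - a))"
      using False a openin_subset[OF U] by (intro level_add_indicator_ge) auto
    moreover have "level X h r \<inter> (U \<inter> level X h (r - a)) = U \<inter> level X h r"
      using antimonoD[OF level_antimono, of "r - a" r h] a by auto
    ultimately show ?thesis
      using False valuation_modular[OF openin_level[OF h] op, of r "r - a"]
      by (simp add: H_def K_def J_def)
  qed
  have shift: "(\<integral>\<^sup>+r. J (r - a) * indicator {a..} r \<partial>lborel) = (\<integral>\<^sup>+r\<in>{0..}. J r \<partial>lborel)"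
    by (subst (2) nn_integral_real_affine[where c = 1 and t = "- a"])
       (auto intro!: nn_integral_cong simp: indicator_def)
  have "(\<integral>\<^sup>+r\<in>{0..}. K r \<partial>lborel) + (\<integral>\<^sup>+r\<in>{0..}. J r \<partial>lborel) =
      (\<integral>\<^sup>+r. (K r + J r) * indicator {0..} r \<partial>lborel)"
    by (subst nn_integral_add[symmetric]) (auto simp: distrib_right)
  also have "\<dots> = (\<integral>\<^sup>+r. H r * indicator {0..} r +
      (\<mu> U * indicator {0..<a} r + J (r - a) * indicator {a..} r) \<partial>lborel)"
    using a by (intro nn_integral_cong) (auto simp: indicator_def pointwise)
  also have "\<dots> = (\<integral>\<^sup>+r\<in>{0..}. H r \<partial>lborel) + (ennreal a * \<mu> U + (\<integral>\<^sup>+r\<in>{0..}. J r \<partial>lborel))"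
    using a by (simp add: nn_integral_add nn_integral_cmult shift) (simp add: mult.commute)
  finally have eq: "(\<integral>\<^sup>+r\<in>{0..}. J r \<partial>lborel) + (\<integral>\<^sup>+r\<in>{0..}. K r \<partial>lborel) =
      (\<integral>\<^sup>+r\<in>{0..}. J r \<partial>lborel) + ((\<integral>\<^sup>+r\<in>{0..}. H r \<partial>lborel) + ennreal a * \<mu> U)"
    by (simp add: ac_simps)
  have JH: "(\<integral>\<^sup>+r\<in>{0..}. J r \<partial>lborel) \<le> (\<integral>\<^sup>+r\<in>{0..}. H r \<partial>lborel)"
    unfolding J_def H_def by (intro nn_integral_mono mult_right_mono valuation_mono op openin_level h) auto
  have HK: "(\<integral>\<^sup>+r\<in>{0..}. H r \<partial>lborel) \<le> (\<integral>\<^sup>+r\<in>{0..}. K r \<partial>lborel)"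
    using val_integral_mono[OF h lsc_add_indicator[OF h U a]]
    by (simp add: H_def K_def val_integral_def level_def)
  have "(\<integral>\<^sup>+r\<in>{0..}. K r \<partial>lborel) = (\<integral>\<^sup>+r\<in>{0..}. H r \<partial>lborel) + ennreal a * \<mu> U"
  proof (cases "(\<integral>\<^sup>+r\<in>{0..}. J r \<partial>lborel) = top")
    case True
    with JH HK show ?thesis by (simp add: top_unique)
  next
    case False
    with eq show ?thesis by (simp only: ennreal_add_left_cancel infinity_ennreal_def simp_thms)
  qed
  then show ?thesis by (simp add: H_def K_def val_integral_def level_def)
qed

text \<open>Semi-continuity and the value of the integral are proved together because adding the
  next indicator requires the partial sum to be lower semi-continuous.\<close>

lemma val_integral_add_sum_indicator:
  assumes h: "lsc X h" and "finite K" and "\<And>k. k \<in> K \<Longrightarrow> openin X (U k)" and "\<And>k. k \<in> K \<Longrightarrow> 0 \<le> a k"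
  shows "lsc X (\<lambda>x. h x + (\<Sum>k\<in>K. ennreal (a k) * indicator (U k) x)) \<and>
    val_integral X (\<lambda>x. h x + (\<Sum>k\<in>K. ennreal (a k) * indicator (U k) x)) \<mu> =
      val_integral X h \<mu> + (\<Sum>k\<in>K. ennreal (a k) * \<mu> (U k))"
  using assms(2-)
proof induction
  case empty
  then show ?case using h by simp
next
  case (insert m K)
  let ?g = "\<lambda>x. h x + (\<Sum>k\<in>K. ennreal (a k) * indicator (U k) x)"
  have "lsc X ?g" and "val_integral X ?g \<mu> = val_integral X h \<mu> + (\<Sum>k\<in>K. ennreal (a k) * \<mu> (U k))"
    using insert by auto
  with insert.prems lsc_add_indicator[of X ?g "U m" "a m"] val_integral_add_indicator[of ?g "U m" "a m"]
  show ?case using insert.hyps by (simp add: ac_simps del: sum_mult_indicator)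
qed

end

section \<open>Dirac valuations and the dyadic approximation of an integrand\<close>

lemma continuous_valuation_dirac: "continuous_valuation X (dirac X x)"
proof -
  have "(if x \<in> \<Union>D then 1 else 0) = (SUP U\<in>D. if x \<in> U then 1 else (0::ennreal))"
    if "directed_family D" for D
  proof (cases "x \<in> \<Union>D")
    case True
    then obtain U where U: "U \<in> D" "x \<in> U" by blast
    have "1 \<le> (SUP U\<in>D. if x \<in> U then 1 else (0::ennreal))"
      using U by (intro SUP_upper2[OF U(1)]) simp
    moreover have "(SUP U\<in>D. if x \<in> U then 1 else (0::ennreal)) \<le> 1"
      by (intro SUP_least) simp
    ultimately show ?thesis using True by (simp only: if_True antisym)
  next
    case False
    then have "(SUP U\<in>D. if x \<in> U then 1 else (0::ennreal)) = (SUP U\<in>D. 0)"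
      by (intro SUP_cong) auto
    with False that show ?thesis by (simp add: directed_family_def)
  qed
  then show ?thesis
    unfolding continuous_valuation_def
    by (auto simp: dirac_def openin_Union subset_iff intro!: SUP_cong)
qed

text \<open>The layer-cake formula for a single value: the integrand is the indicator of
  \<open>[0, y)\<close>. With \<open>y = h x\<close> it is the mass that the Dirac valuation at
  \<open>x\<close> gives to \<open>{h > r}\<close>.\<close>

lemma nn_integral_indicator_less: "(\<integral>\<^sup>+r\<in>{0..}. (if ennreal r < y then 1 else 0) \<partial>lborel) = y"
proof (cases y rule: ennreal_cases)
  case (real b)
  have "(\<integral>\<^sup>+r\<in>{0..}. (if ennreal r < y then 1 else 0) \<partial>lborel) = (\<integral>\<^sup>+r. indicator {0..<b} r \<partial>lborel)"
    using real by (intro nn_integral_cong) (auto simp: indicator_def ennreal_less_iff)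
  with real show ?thesis by simp
next
  case top
  have "(\<integral>\<^sup>+r\<in>{0..}. (if ennreal r < y then 1 else 0) \<partial>lborel) = (\<integral>\<^sup>+r. indicator {0::real..} r \<partial>lborel)"
    using top by (intro nn_integral_cong) (auto simp: indicator_def)
  also have "\<dots> = emeasure lborel {0::real..}" by simp
  also have "\<dots> = top"
  proof (rule ccontr)
    assume "emeasure lborel {0::real..} \<noteq> top"
    then obtain n :: nat where "emeasure lborel {0::real..} < of_nat n"
      using ennreal_Ex_less_of_nat by (auto simp: less_top)
    moreover have "emeasure lborel {0..real n} \<le> emeasure lborel {0::real..}"
      by (intro emeasure_mono) auto
    ultimately show False by (simp add: ennreal_of_nat_eq_real_of_nat)
  qed
  finally show ?thesis using top by simp
qed

lemma val_integral_dirac: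
  assumes "lsc X h" "x \<in> topspace X"
  shows "val_integral X h (dirac X x) = h x"
proof -
  have "dirac X x (level X h r) = (if ennreal r < h x then 1 else 0)" for r
    using assms openin_level[OF assms(1), of r] by (simp add: dirac_def) (simp add: level_def)
  then show ?thesis
    by (simp add: val_integral_def level_def[symmetric] nn_integral_indicator_less)
qed

lemma incseq_lower_sum_indicator:
  "incseq (\<lambda>n. lower_sum n (\<lambda>r. indicator (level X h r) x))"
  by (intro incseq_lower_sum)
     (auto simp: antimono_def indicator_def level_def dest: ennreal_leI intro: le_less_trans)

text \<open>Integrating \<open>h\<close> against the Dirac valuation at \<open>x\<close> gives
  \<open>h x\<close> on the one hand and a supremum of lower sums on the other. So \<open>h\<close>
  is a supremum of finite combinations of indicators of its level sets.\<close>

lemma lsc_eq_SUP_lower_sum: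
  assumes "lsc X h" "x \<in> topspace X"
  shows "h x = (SUP n. lower_sum n (\<lambda>r. indicator (level X h r) x))"
proof -
  have "dirac X x (level X h r) = indicator (level X h r) x" for r
    using openin_level[OF assms(1), of r] by (simp add: dirac_def indicator_def)
  then show ?thesis
    using val_integral_eq_SUP_lower_sum[OF continuous_valuation_dirac assms(1)] val_integral_dirac[OF assms]
    by simp
qed

section \<open>Linearity of the integral in the integrand\<close>

lemma mult_lower_sum: "0 \<le> c \<Longrightarrow>
    ennreal c * lower_sum n f = (\<Sum>k<n * 2 ^ n. ennreal (c / 2 ^ n) * f (real (Suc k) / 2 ^ n))"
  unfolding lower_sum_def sum_distrib_left
  by (intro sum.cong refl) (simp flip: mult.assoc ennreal_mult)

text \<open>Replacing \<open>g\<close> by its dyadic sums reduces both claims to adding finitely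
  many indicators to \<open>h\<close>; lower semi-continuity and integration then pass to the
  supremum over \<open>n\<close>.\<close>

lemma lsc_and_val_integral_add_scale:
  assumes val: "continuous_valuation X \<mu>" and h: "lsc X h" and g: "lsc X g" and c: "0 \<le> c"
  shows "lsc X (\<lambda>x. h x + ennreal c * g x) \<and>
    val_integral X (\<lambda>x. h x + ennreal c * g x) \<mu> = val_integral X h \<mu> + ennreal c * val_integral X g \<mu>"
proof -
  define s where "s n x = h x + ennreal c * lower_sum n (\<lambda>r. indicator (level X g r) x)" for n x
  have s: "lsc X (s n) \<and>
      val_integral X (s n) \<mu> = val_integral X h \<mu> + ennreal c * lower_sum n (\<lambda>r. \<mu> (level X g r))" for n
    unfolding s_def[abs_def] mult_lower_sum[OF c]
    by (rule val_integral_add_sum_indicator[OF val h]) (auto intro: openin_level[OF g] simp: c)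
  have sum: "h x + ennreal c * g x = (SUP n. s n x)" if "x \<in> topspace X" for x
    unfolding lsc_eq_SUP_lower_sum[OF g that] s_def
    by (simp add: SUP_mult_left_ennreal ennreal_SUP_add_right)
  have "val_integral X (\<lambda>x. h x + ennreal c * g x) \<mu> = val_integral X (\<lambda>x. SUP n. s n x) \<mu>"
    using sum by (rule val_integral_cong[OF val])
  also have "\<dots> = (SUP n. val_integral X (s n) \<mu>)"
  proof (rule val_integral_SUP_directed[OF val])
    fix i j :: nat
    show "\<exists>k\<in>UNIV. \<forall>x\<in>topspace X. s i x \<le> s k x \<and> s j x \<le> s k x"
      unfolding s_def
      by (intro bexI[of _ "max i j"] ballI conjI add_left_mono mult_left_mono
          incseqD[OF incseq_lower_sum_indicator]) auto
  qed (use s in auto)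
  also have "\<dots> = val_integral X h \<mu> + ennreal c * val_integral X g \<mu>"
    using s by (simp add: val_integral_eq_SUP_lower_sum[OF val g] SUP_mult_left_ennreal ennreal_SUP_add_right)
  finally show ?thesis
    using lsc_SUP[of UNIV X s] s lsc_cong[of X, OF sum] by simp
qed

lemma val_integral_add:
  assumes "continuous_valuation X \<mu>" "lsc X h" "lsc X g"
  shows "val_integral X (\<lambda>x. h x + g x) \<mu> = val_integral X h \<mu> + val_integral X g \<mu>"
  using lsc_and_val_integral_add_scale[OF assms, of 1] by simp

lemma lsc_zero: "lsc X (\<lambda>x. 0)"
  by (simp add: continuous_map_const)

lemma val_integral_zero: "continuous_valuation X \<mu> \<Longrightarrow> val_integral X (\<lambda>x. 0) \<mu> = 0"
  by (simp add: val_integral_def valuation_empty)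

text \<open>With one weight \<open>c\<close> for all terms this has the shape of a lower sum; it
  serves to integrate a lower sum whose terms are evaluations of valuations.\<close>

lemma lsc_and_val_integral_sum:
  assumes val: "continuous_valuation X \<mu>" and "finite K"
    and "\<And>k. k \<in> K \<Longrightarrow> lsc X (g k)" and c: "0 \<le> c"
  shows "lsc X (\<lambda>x. \<Sum>k\<in>K. ennreal c * g k x) \<and>
    val_integral X (\<lambda>x. \<Sum>k\<in>K. ennreal c * g k x) \<mu> = (\<Sum>k\<in>K. ennreal c * val_integral X (g k) \<mu>)"
  using assms(2,3)
proof induction
  case empty
  then show ?case using val by (simp add: val_integral_zero lsc_zero)
next
  case (insert m K)
  with lsc_and_val_integral_add_scale[OF val, of "\<lambda>x. \<Sum>k\<in>K. ennreal c * g k x" "g m" c] c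
  show ?case by (simp add: add.commute)
qed

section \<open>Linear combinations of valuations, and linearity of the integral in the
  valuation\<close>

lemma continuous_valuation_zero: "continuous_valuation X (val_zero X)"
  unfolding continuous_valuation_def
  by (auto simp: val_zero_def openin_Union subset_iff directed_family_def)

lemma continuous_valuation_add:
  assumes \<mu>: "continuous_valuation X \<mu>" and \<nu>: "continuous_valuation X \<nu>"
  shows "continuous_valuation X (val_add X \<mu> \<nu>)"
  unfolding continuous_valuation_def
proof (intro conjI allI impI)
  fix U V assume U: "openin X U" and V: "openin X V"
  show "val_add X \<mu> \<nu> U \<le> val_add X \<mu> \<nu> V" if "U \<subseteq> V"
    using U V that by (simp add: val_add_def add_mono valuation_mono[OF \<mu>] valuation_mono[OF \<nu>])
  show "val_add X \<mu> \<nu> U + val_add X \<mu> \<nu> V = val_add X \<mu> \<nu> (U \<union> V) + val_add X \<mu> \<nu> (U \<inter> V)"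
  proof -
    have "(\<mu> U + \<mu> V) + (\<nu> U + \<nu> V) = (\<mu> (U \<union> V) + \<mu> (U \<inter> V)) + (\<nu> (U \<union> V) + \<nu> (U \<inter> V))"
      using valuation_modular[OF \<mu> U V] valuation_modular[OF \<nu> U V] by simp
    with U V show ?thesis by (simp add: val_add_def openin_Un openin_Int ac_simps)
  qed
next
  fix D assume D: "D \<subseteq> opens X" "directed_family D"
  \<comment> \<open>By directedness and monotonicity the two suprema can be approached along a
    common open set \<open>W\<close>.\<close>
  have "(SUP U\<in>D. \<mu> U + \<nu> U) = (SUP U\<in>D. \<mu> U) + (SUP U\<in>D. \<nu> U)"
  proof (rule SUP_add_directed_ennreal)
    fix U V assume "U \<in> D" "V \<in> D"
    moreover from this obtain W where "W \<in> D" "U \<subseteq> W" "V \<subseteq> W"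
      using D(2) unfolding directed_family_def by metis
    ultimately show "\<exists>W\<in>D. \<mu> U + \<nu> V \<le> \<mu> W + \<nu> W"
      using D(1) by (intro bexI[of _ W] add_mono valuation_mono[OF \<mu>] valuation_mono[OF \<nu>]) auto
  qed
  moreover have "openin X (\<Union>D)" using D by auto
  moreover have "(SUP U\<in>D. val_add X \<mu> \<nu> U) = (SUP U\<in>D. \<mu> U + \<nu> U)"
    using D by (intro SUP_cong) (auto simp: val_add_def)
  ultimately show "val_add X \<mu> \<nu> (\<Union>D) = (SUP U\<in>D. val_add X \<mu> \<nu> U)"
    by (simp add: val_add_def valuation_Union_directed[OF \<mu> D] valuation_Union_directed[OF \<nu> D])
qed (simp_all add: val_add_def valuation_empty[OF \<mu>] valuation_empty[OF \<nu>])

lemma continuous_valuation_scale: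
  assumes \<mu>: "continuous_valuation X \<mu>"
  shows "continuous_valuation X (val_scale X r \<mu>)"
  unfolding continuous_valuation_def
proof (intro conjI allI impI)
  fix U V assume U: "openin X U" and V: "openin X V"
  show "val_scale X r \<mu> U \<le> val_scale X r \<mu> V" if "U \<subseteq> V"
    using U V that by (simp add: val_scale_def mult_left_mono valuation_mono[OF \<mu>])
  show "val_scale X r \<mu> U + val_scale X r \<mu> V = val_scale X r \<mu> (U \<union> V) + val_scale X r \<mu> (U \<inter> V)"
    using U V valuation_modular[OF \<mu> U V]
    by (simp add: val_scale_def openin_Un openin_Int flip: distrib_left)
next
  fix D assume D: "D \<subseteq> opens X" "directed_family D"
  have "(SUP U\<in>D. val_scale X r \<mu> U) = (SUP U\<in>D. ennreal r * \<mu> U)"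
    using D by (intro SUP_cong) (auto simp: val_scale_def)
  moreover have "openin X (\<Union>D)" using D by auto
  ultimately show "val_scale X r \<mu> (\<Union>D) = (SUP U\<in>D. val_scale X r \<mu> U)"
    by (simp add: val_scale_def valuation_Union_directed[OF \<mu> D] SUP_mult_left_ennreal)
qed (simp_all add: val_scale_def valuation_empty[OF \<mu>])

lemma val_integral_val_zero: "lsc X h \<Longrightarrow> val_integral X h (val_zero X) = 0"
  unfolding val_integral_def level_def[symmetric] by (simp add: val_zero_def openin_level)

lemma val_integral_val_add:
  assumes \<mu>: "continuous_valuation X \<mu>" and \<nu>: "continuous_valuation X \<nu>" and h: "lsc X h"
  shows "val_integral X h (val_add X \<mu> \<nu>) = val_integral X h \<mu> + val_integral X h \<nu>"
proof -
  have [measurable]: "(\<lambda>r. \<mu> (level X h r)) \<in> borel_measurable borel" "(\<lambda>r. \<nu> (level X h r)) \<in> borel_measurable borel"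
    by (intro borel_measurable_antimono_ennreal antimono_valuation_level \<mu> \<nu> h)+
  show ?thesis
    unfolding val_integral_def level_def[symmetric]
    by (subst nn_integral_add[symmetric])
       (auto simp: val_add_def openin_level[OF h] distrib_right)
qed

lemma val_integral_val_scale:
  assumes \<mu>: "continuous_valuation X \<mu>" and h: "lsc X h"
  shows "val_integral X h (val_scale X r \<mu>) = ennreal r * val_integral X h \<mu>"
proof -
  have [measurable]: "(\<lambda>r. \<mu> (level X h r)) \<in> borel_measurable borel"
    by (intro borel_measurable_antimono_ennreal antimono_valuation_level \<mu> h)
  show ?thesis
    unfolding val_integral_def level_def[symmetric]
    by (subst nn_integral_cmult[symmetric])
       (auto simp: val_scale_def openin_level[OF h] mult.assoc)
qed

section \<open>The weak topology and the monad\<close>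

text \<open>The superlevel sets of evaluation at \<open>U\<close> are the subbasic sets
  \<open>[U > r]\<close>.\<close>

lemma lsc_eval: "openin X U \<Longrightarrow> lsc (Vw X) (\<lambda>\<mu>. \<mu> U)"
  unfolding lsc_iff level_def topspace_Vw
  unfolding Vw_def by (auto intro!: topology_generated_by_Basis)

text \<open>The universal property of the weak topology: continuity into it is tested on evaluations
  at open sets.\<close>

lemma continuous_map_Vw:
  assumes "\<And>y. y \<in> topspace Y \<Longrightarrow> continuous_valuation X (f y)"
    and "\<And>U. openin X U \<Longrightarrow> lsc Y (\<lambda>y. f y U)"
  shows "continuous_map Y (Vw X) f"
  unfolding Vw_def
proof (rule continuous_on_generated_topo)
  fix W assume "W \<in> insert {\<mu>. continuous_valuation X \<mu>}
    {{\<mu>. continuous_valuation X \<mu> \<and> ennreal r < \<mu> U} | U r. openin X U \<and> 0 \<le> r}"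
  then consider "W = {\<mu>. continuous_valuation X \<mu>}"
    | U r where "openin X U" "W = {\<mu>. continuous_valuation X \<mu> \<and> ennreal r < \<mu> U}"
    by blast
  then show "openin Y (f -` W \<inter> topspace Y)"
  proof cases
    case 1
    then have "f -` W \<inter> topspace Y = topspace Y" using assms(1) by auto
    then show ?thesis by simp
  next
    case 2
    then have "f -` W \<inter> topspace Y = level Y (\<lambda>y. f y U) r" using assms(1) by (auto simp: level_def)
    then show ?thesis using assms(2) 2 by (simp add: openin_level)
  qed
qed (use assms(1) in auto)

text \<open>Induction on the generation of the topology. A finite set \<open>F\<close> of pairs
  records a finite intersection of subbasic sets \<open>[U > r]\<close>, and the empty
  \<open>F\<close> stands for the whole carrier.\<close>

lemma openin_Vw_basic_nbhd:
  assumes "openin (Vw X) W" "\<mu> \<in> W"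
  obtains F where "finite F" "\<And>U r. (U, r) \<in> F \<Longrightarrow> openin X U \<and> 0 \<le> r \<and> ennreal r < \<mu> U"
    "\<And>\<nu>. continuous_valuation X \<nu> \<Longrightarrow> (\<And>U r. (U, r) \<in> F \<Longrightarrow> ennreal r < \<nu> U) \<Longrightarrow> \<nu> \<in> W"
proof -
  define Q where "Q F = (\<forall>(U, r)\<in>F. openin X U \<and> 0 \<le> r \<and> ennreal r < \<mu> U)" for F
  define N where "N F = {\<nu>. continuous_valuation X \<nu> \<and> (\<forall>(U, r)\<in>F. ennreal r < \<nu> U)}" for F
  have "generate_topology_on (insert {\<mu>. continuous_valuation X \<mu>}
       {{\<mu>. continuous_valuation X \<mu> \<and> ennreal r < \<mu> U} | U r. openin X U \<and> 0 \<le> r}) W"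
    using assms(1) unfolding Vw_def by (rule openin_topology_generated_by)
  then have "\<mu> \<in> W \<Longrightarrow> \<exists>F. finite F \<and> Q F \<and> N F \<subseteq> W"
  proof induction
    case Empty
    then show ?case by simp
  next
    case (Int a b)
    then obtain F G where "finite F" "Q F" "N F \<subseteq> a" "finite G" "Q G" "N G \<subseteq> b"
      by (meson IntD1 IntD2)
    moreover from this have "Q (F \<union> G)" by (simp add: Q_def ball_Un)
    moreover have "N (F \<union> G) = N F \<inter> N G" unfolding N_def ball_Un by blast
    ultimately show ?case by (intro exI[of _ "F \<union> G"]) blast
  next
    case (UN K)
    then show ?case by (meson Union_iff Union_upper subset_trans)
  next
    case (Basis s)
    then consider "s = {\<mu>. continuous_valuation X \<mu>}"
      | U r where "openin X U" "0 \<le> r" "s = {\<mu>. continuous_valuation X \<mu> \<and> ennreal r < \<mu> U}"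
      by blast
    then show ?case
    proof cases
      case 1
      then show ?thesis by (intro exI[of _ "{}"]) (simp add: Q_def N_def)
    next
      case 2
      with Basis.prems show ?thesis by (intro exI[of _ "{(U, r)}"]) (simp add: Q_def N_def)
    qed
  qed
  with assms(2) obtain F where F: "finite F" "Q F" "N F \<subseteq> W" by blast
  show thesis
  proof (rule that[of F])
    show "openin X U \<and> 0 \<le> r \<and> ennreal r < \<mu> U" if "(U, r) \<in> F" for U r
      using F(2) that by (auto simp: Q_def)
    show "\<nu> \<in> W" if "continuous_valuation X \<nu>" "\<And>U r. (U, r) \<in> F \<Longrightarrow> ennreal r < \<nu> U" for \<nu>
      using that by (intro subsetD[OF F(3)]) (auto simp: N_def)
  qed (fact F(1))
qed

text \<open>Basic neighbourhoods impose only strict lower bounds, so larger valuations satisfy them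
  too.\<close>

lemma openin_Vw_upward_closed:
  assumes "openin (Vw X) W" "\<mu> \<in> W" "continuous_valuation X \<nu>"
    and "\<And>U. openin X U \<Longrightarrow> \<mu> U \<le> \<nu> U"
  shows "\<nu> \<in> W"
proof -
  obtain F where F: "\<And>U r. (U, r) \<in> F \<Longrightarrow> openin X U \<and> 0 \<le> r \<and> ennreal r < \<mu> U"
    "\<And>\<nu>. continuous_valuation X \<nu> \<Longrightarrow> (\<And>U r. (U, r) \<in> F \<Longrightarrow> ennreal r < \<nu> U) \<Longrightarrow> \<nu> \<in> W"
    using assms(1,2) by (rule openin_Vw_basic_nbhd) blast
  show ?thesis
  proof (rule F(2)[OF assms(3)])
    fix U r assume "(U, r) \<in> F"
    then show "ennreal r < \<nu> U" using F(1) assms(4) less_le_trans by metis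
  qed
qed

section \<open>Push-forward and monad multiplication\<close>

lemma continuous_valuation_Vw_map:
  assumes f: "continuous_map X Y f" and \<mu>: "continuous_valuation X \<mu>"
  shows "continuous_valuation Y (Vw_map X Y f \<mu>)"
proof -
  define P where "P V = {x \<in> topspace X. f x \<in> V}" for V
  have P: "openin X (P V)" if "openin Y V" for V
    unfolding P_def using f that by (rule openin_continuous_map_preimage)
  have PU: "P (U \<union> V) = P U \<union> P V" "P (U \<inter> V) = P U \<inter> P V" for U V
    by (auto simp: P_def)
  have map: "Vw_map X Y f \<mu> = (\<lambda>V\<in>opens Y. \<mu> (P V))"
    by (simp add: Vw_map_def P_def)
  show ?thesis
    unfolding continuous_valuation_def map
  proof (intro conjI allI impI)
    fix D assume D: "D \<subseteq> opens Y" "directed_family D"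
    have "P (\<Union>D) = (\<Union>V\<in>D. P V)" by (auto simp: P_def)
    moreover have "\<mu> (\<Union>V\<in>D. P V) = (SUP V\<in>D. \<mu> (P V))"
    proof (rule valuation_UN_directed[OF \<mu>])
      fix U V assume "U \<in> D" "V \<in> D"
      then obtain W where "W \<in> D" "U \<subseteq> W" "V \<subseteq> W" using D(2) unfolding directed_family_def by metis
      then show "\<exists>W\<in>D. P U \<subseteq> P W \<and> P V \<subseteq> P W" by (intro bexI[of _ W]) (auto simp: P_def)
    qed (use D P in \<open>auto simp: directed_family_def\<close>)
    moreover have "(SUP V\<in>D. (\<lambda>V\<in>opens Y. \<mu> (P V)) V) = (SUP V\<in>D. \<mu> (P V))"
      using D by (intro SUP_cong) auto
    moreover have "openin Y (\<Union>D)" using D by auto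
    ultimately show "(\<lambda>V\<in>opens Y. \<mu> (P V)) (\<Union>D) = (SUP V\<in>D. (\<lambda>V\<in>opens Y. \<mu> (P V)) V)"
      by simp
  next
    fix U V assume "openin Y U" "openin Y V"
    then show "(\<lambda>V\<in>opens Y. \<mu> (P V)) U + (\<lambda>V\<in>opens Y. \<mu> (P V)) V =
        (\<lambda>V\<in>opens Y. \<mu> (P V)) (U \<union> V) + (\<lambda>V\<in>opens Y. \<mu> (P V)) (U \<inter> V)"
      using valuation_modular[OF \<mu> P P, of U V] by (simp add: openin_Un openin_Int PU)
  next
    fix U V assume "openin Y U" "openin Y V" "U \<subseteq> V"
    then show "(\<lambda>V\<in>opens Y. \<mu> (P V)) U \<le> (\<lambda>V\<in>opens Y. \<mu> (P V)) V"
      by (auto intro!: valuation_mono[OF \<mu>] P) (auto simp: P_def)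
  qed (simp_all add: P_def valuation_empty[OF \<mu>])
qed

text \<open>Change of variables: the preimage of \<open>{h > r}\<close> under \<open>f\<close> is
  the level set of the composite, so the integrands agree for every \<open>r\<close>.\<close>

lemma val_integral_Vw_map:
  assumes f: "continuous_map X Y f" and h: "lsc Y h"
  shows "val_integral Y h (Vw_map X Y f \<mu>) = val_integral X (\<lambda>x. h (f x)) \<mu>"
proof -
  have "{x \<in> topspace X. f x \<in> level Y h r} = level X (\<lambda>x. h (f x)) r" for r
    using continuous_map_image_subset_topspace[OF f] by (auto simp: level_def)
  then show ?thesis
    unfolding val_integral_def level_def[symmetric] by (simp add: Vw_map_def openin_level[OF h])
qed

text \<open>Each axiom holds pointwise for the integrands \<open>\<lambda>\<mu>. \<mu> U\<close> and
  is carried through the integral by its monotonicity, additivity and commutation with directed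
  suprema.\<close>

lemma continuous_valuation_Vw_mult:
  assumes \<omega>: "continuous_valuation (Vw X) \<omega>"
  shows "continuous_valuation X (Vw_mult X \<omega>)"
  unfolding continuous_valuation_def
proof (intro conjI allI impI)
  have "val_integral (Vw X) (\<lambda>\<mu>. \<mu> {}) \<omega> = val_integral (Vw X) (\<lambda>\<mu>. 0) \<omega>"
    by (rule val_integral_cong[OF \<omega>]) (simp add: valuation_empty)
  then show "Vw_mult X \<omega> {} = 0" by (simp add: Vw_mult_def val_integral_zero[OF \<omega>])
next
  fix U V assume U: "openin X U" and V: "openin X V"
  show "Vw_mult X \<omega> U \<le> Vw_mult X \<omega> V" if "U \<subseteq> V"
    using U V that
    by (auto simp: Vw_mult_def intro!: val_integral_mono[OF \<omega>] lsc_eval valuation_mono)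
  have "val_integral (Vw X) (\<lambda>\<mu>. \<mu> U + \<mu> V) \<omega> = val_integral (Vw X) (\<lambda>\<mu>. \<mu> (U \<union> V) + \<mu> (U \<inter> V)) \<omega>"
    using U V by (intro val_integral_cong[OF \<omega>]) (simp add: valuation_modular)
  with U V show "Vw_mult X \<omega> U + Vw_mult X \<omega> V = Vw_mult X \<omega> (U \<union> V) + Vw_mult X \<omega> (U \<inter> V)"
    by (simp add: Vw_mult_def openin_Un openin_Int val_integral_add[OF \<omega>] lsc_eval)
next
  fix D assume D: "D \<subseteq> opens X" "directed_family D"
  have "val_integral (Vw X) (\<lambda>\<mu>. \<mu> (\<Union>D)) \<omega> = val_integral (Vw X) (\<lambda>\<mu>. SUP U\<in>D. \<mu> U) \<omega>"
    using D by (intro val_integral_cong[OF \<omega>]) (simp add: valuation_Union_directed)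
  also have "\<dots> = (SUP U\<in>D. val_integral (Vw X) (\<lambda>\<mu>. \<mu> U) \<omega>)"
  proof (rule val_integral_SUP_directed[OF \<omega>])
    fix U V assume UV: "U \<in> D" "V \<in> D"
    then obtain W where "W \<in> D" "U \<subseteq> W" "V \<subseteq> W" using D(2) unfolding directed_family_def by metis
    with D UV show "\<exists>W\<in>D. \<forall>\<mu>\<in>topspace (Vw X). \<mu> U \<le> \<mu> W \<and> \<mu> V \<le> \<mu> W"
      by (intro bexI[of _ W]) (auto intro!: valuation_mono)
  qed (use D in \<open>auto simp: directed_family_def intro: lsc_eval\<close>)
  also have "\<dots> = (SUP U\<in>D. Vw_mult X \<omega> U)"
    using D by (intro SUP_cong) (auto simp: Vw_mult_def)
  moreover have "openin X (\<Union>D)" using D by auto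
  ultimately show "Vw_mult X \<omega> (\<Union>D) = (SUP U\<in>D. Vw_mult X \<omega> U)"
    by (simp add: Vw_mult_def)
qed (simp add: Vw_mult_def)

text \<open>An exchange of integrals. The inner integral is the supremum of the lower sums
  \<open>s n\<close>, each a finite combination of evaluations, so linearity handles each
  \<open>n\<close> and directed continuity the supremum.\<close>

lemma val_integral_Vw_mult:
  assumes \<omega>: "continuous_valuation (Vw X) \<omega>" and h: "lsc X h"
  shows "val_integral X h (Vw_mult X \<omega>) = val_integral (Vw X) (val_integral X h) \<omega>"
proof -
  define s where "s n \<mu> = lower_sum n (\<lambda>r. \<mu> (level X h r))" for n and \<mu> :: "'a set \<Rightarrow> ennreal"
  have s: "lsc (Vw X) (s n) \<and>
      val_integral (Vw X) (s n) \<omega> = lower_sum n (\<lambda>r. val_integral (Vw X) (\<lambda>\<mu>. \<mu> (level X h r)) \<omega>)" for n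
    unfolding s_def[abs_def] lower_sum_def
    by (rule lsc_and_val_integral_sum[OF \<omega>]) (auto intro: lsc_eval openin_level[OF h])
  have "val_integral X h (Vw_mult X \<omega>) = (SUP n. lower_sum n (\<lambda>r. Vw_mult X \<omega> (level X h r)))"
    using \<omega> by (intro val_integral_eq_SUP_lower_sum continuous_valuation_Vw_mult h)
  also have "\<dots> = (SUP n. val_integral (Vw X) (s n) \<omega>)"
    using s by (simp add: Vw_mult_def openin_level[OF h])
  also have "\<dots> = val_integral (Vw X) (\<lambda>\<mu>. SUP n. s n \<mu>) \<omega>"
  proof (rule val_integral_SUP_directed[OF \<omega>, symmetric])
    fix i j :: nat
    \<comment> \<open>The sums increase with \<open>n\<close> because the masses of the level sets
      are antitone, which is available for continuous valuations.\<close>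
    have "s i \<mu> \<le> s k \<mu>" if "i \<le> k" "\<mu> \<in> topspace (Vw X)" for i k \<mu>
      using that incseqD[OF incseq_lower_sum[OF antimono_valuation_level[OF _ h]]]
      by (simp add: s_def)
    then show "\<exists>k\<in>UNIV. \<forall>\<mu>\<in>topspace (Vw X). s i \<mu> \<le> s k \<mu> \<and> s j \<mu> \<le> s k \<mu>"
      by (intro bexI[of _ "max i j"]) auto
  qed (use s in auto)
  also have "\<dots> = val_integral (Vw X) (val_integral X h) \<omega>"
    using h by (intro val_integral_cong[OF \<omega>]) (simp add: s_def val_integral_eq_SUP_lower_sum)
  finally show ?thesis .
qed

section \<open>Irreducible closed sets\<close>

text \<open>The Dirac valuation at the generic point of \<open>F\<close>, which need not exist yet in \<open>X\<close>.\<close>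

definition meets_valuation :: "'a topology \<Rightarrow> 'a set \<Rightarrow> 'a set \<Rightarrow> ennreal" where
  "meets_valuation X F = (\<lambda>U\<in>opens X. if U \<inter> F = {} then 0 else 1)"

text \<open>Irreducibility read through complements: if two open sets meet \<open>F\<close>, so does
  their intersection. Induction extends this to finitely many.\<close>

lemma irreducible_closedin_finite_Int:
  assumes F: "irreducible_closedin X F" and "finite K"
    and "\<And>k. k \<in> K \<Longrightarrow> openin X (U k) \<and> U k \<inter> F \<noteq> {}"
  shows "\<exists>y\<in>F. \<forall>k\<in>K. y \<in> U k"
proof -
  \<comment> \<open>Intersecting with the carrier gives the empty family an open intersection; that
    set meets \<open>F\<close> because \<open>F\<close> is nonempty.\<close>
  have "openin X (topspace X \<inter> (\<Inter>k\<in>K. U k)) \<and> topspace X \<inter> (\<Inter>k\<in>K. U k) \<inter> F \<noteq> {}"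
    using assms(2,3)
  proof induction
    case empty
    then show ?case
      using F closedin_subset by (fastforce simp: irreducible_closedin_def)
  next
    case (insert m K)
    define V where "V = topspace X \<inter> (\<Inter>k\<in>K. U k)"
    have V: "openin X V" "V \<inter> F \<noteq> {}" and U: "openin X (U m)" "U m \<inter> F \<noteq> {}"
      using insert by (auto simp: V_def)
    have "F \<subseteq> topspace X" using F by (simp add: irreducible_closedin_def closedin_subset)
    have "closedin X (topspace X - U m)" "closedin X (topspace X - V)"
      using U V by auto
    then have "\<not> F \<subseteq> (topspace X - U m) \<union> (topspace X - V)"
      using F U V unfolding irreducible_closedin_def by blast
    then have "U m \<inter> V \<inter> F \<noteq> {}" using \<open>F \<subseteq> topspace X\<close> by blast
    moreover have "topspace X \<inter> (\<Inter>k\<in>insert m K. U k) = U m \<inter> V" by (auto simp: V_def)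
    ultimately show ?case using U V by auto
  qed
  then show ?thesis by blast
qed

text \<open>Modularity for two open sets that both meet \<open>F\<close> is irreducibility: their
  intersection meets \<open>F\<close> as well. A union meets \<open>F\<close> exactly when a member
  does, which gives continuity.\<close>

lemma continuous_valuation_meets:
  assumes F: "irreducible_closedin X F"
  shows "continuous_valuation X (meets_valuation X F)"
proof -
  have inter: "U \<inter> V \<inter> F \<noteq> {}"
    if "openin X U" "openin X V" "U \<inter> F \<noteq> {}" "V \<inter> F \<noteq> {}" for U V
    using irreducible_closedin_finite_Int[OF F, of "{U, V}" "\<lambda>U. U"] that by auto
  show ?thesis
    unfolding continuous_valuation_def
  proof (intro conjI allI impI)
    fix U V assume UV: "openin X U" "openin X V"
    show "meets_valuation X F U \<le> meets_valuation X F V" if "U \<subseteq> V"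
      using UV that by (auto simp: meets_valuation_def)
    show "meets_valuation X F U + meets_valuation X F V =
        meets_valuation X F (U \<union> V) + meets_valuation X F (U \<inter> V)"
      using UV inter[OF UV]
      by (cases "U \<inter> F = {}"; cases "V \<inter> F = {}")
         (auto simp: meets_valuation_def openin_Un openin_Int Int_Un_distrib2)
  next
    fix D assume D: "D \<subseteq> opens X" "directed_family D"
    have "openin X (\<Union>D)" using D by auto
    have le: "meets_valuation X F U \<le> 1" if "openin X U" for U
      using that by (simp add: meets_valuation_def)
    show "meets_valuation X F (\<Union>D) = (SUP U\<in>D. meets_valuation X F U)"
    proof (cases "\<Union>D \<inter> F = {}")
      case True
      have "(SUP U\<in>D. meets_valuation X F U) = (SUP U\<in>D. 0)"
        using True D by (intro SUP_cong) (auto simp: meets_valuation_def)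
      with True D \<open>openin X (\<Union>D)\<close> show ?thesis
        by (simp add: meets_valuation_def directed_family_def)
    next
      case False
      then obtain U where U: "U \<in> D" "U \<inter> F \<noteq> {}" by blast
      then have "1 \<le> (SUP U\<in>D. meets_valuation X F U)"
        using D by (intro SUP_upper2[OF U(1)]) (auto simp: meets_valuation_def)
      moreover have "(SUP U\<in>D. meets_valuation X F U) \<le> 1"
        using D le by (intro SUP_least) auto
      ultimately show ?thesis
        using False \<open>openin X (\<Union>D)\<close> by (simp add: meets_valuation_def)
    qed
  qed (simp_all add: meets_valuation_def)
qed

section \<open>Cones with unique barycentres\<close>

lemma (in cone_on) linear_functional_onD:
  assumes L: "linear_functional_on C add scal \<Lambda>"
  shows linear_functional_add: "x \<in> C \<Longrightarrow> y \<in> C \<Longrightarrow> \<Lambda> (add x y) = \<Lambda> x + \<Lambda> y"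
    and linear_functional_scale: "0 \<le> r \<Longrightarrow> x \<in> C \<Longrightarrow> \<Lambda> (scal r x) = ennreal r * \<Lambda> x"
    and linear_functional_zero: "\<Lambda> zero = 0"
proof -
  have lin: "\<Lambda> (add (scal r x) (scal s y)) = ennreal r * \<Lambda> x + ennreal s * \<Lambda> y"
    if "0 \<le> r" "0 \<le> s" "x \<in> C" "y \<in> C" for r s x y
    using L that by (simp add: linear_functional_on_def)
  show "\<Lambda> (add x y) = \<Lambda> x + \<Lambda> y" if "x \<in> C" "y \<in> C"
    using lin[of 1 1 x y] that by (simp add: one_scale)
  show scale: "\<Lambda> (scal r x) = ennreal r * \<Lambda> x" if "0 \<le> r" "x \<in> C" for r x
    \<comment> \<open>\<open>add_scale\<close> rewrites the sum of \<open>scal r x\<close> and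
      \<open>scal 0 x\<close> as \<open>scal r x\<close>.\<close>
    using lin[of r 0 x x] add_scale[of r 0 x] that by simp
  show "\<Lambda> zero = 0"
    using scale[of 0 zero] by (simp add: zero_closed zero_scale)
qed

locale barycentric_cone = semitopological_cone X add zero scal
  for X :: "'a topology" and add zero scal +
  fixes \<alpha> :: "('a set \<Rightarrow> ennreal) \<Rightarrow> 'a"
  assumes continuous_alpha: "continuous_map (Vw X) X \<alpha>"
    and barycentre_alpha: "continuous_valuation X \<nu> \<Longrightarrow> barycentre X add scal \<nu> (\<alpha> \<nu>)"
    and barycentre_unique: "continuous_valuation X \<nu> \<Longrightarrow> barycentre X add scal \<nu> b \<Longrightarrow> b = \<alpha> \<nu>"
begin

lemma alpha_closed: "continuous_valuation X \<nu> \<Longrightarrow> \<alpha> \<nu> \<in> topspace X"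
  using barycentre_alpha by (simp add: barycentre_def)

text \<open>Uniqueness as a proof rule: a candidate value of \<open>\<alpha>\<close> has to be
  tested only against linear lower semi-continuous maps.\<close>

lemma alpha_eqI:
  assumes "continuous_valuation X \<nu>" "b \<in> topspace X"
    and "\<And>\<Lambda>. linear_functional_on (topspace X) add scal \<Lambda> \<Longrightarrow> lsc X \<Lambda> \<Longrightarrow> \<Lambda> b = val_integral X \<Lambda> \<nu>"
  shows "\<alpha> \<nu> = b"
  using assms by (intro barycentre_unique[symmetric]) (auto simp: barycentre_def)

lemma functional_alpha:
  assumes "continuous_valuation X \<nu>" "linear_functional_on (topspace X) add scal \<Lambda>" "lsc X \<Lambda>"
  shows "\<Lambda> (\<alpha> \<nu>) = val_integral X \<Lambda> \<nu>"
  using barycentre_alpha[OF assms(1)] assms(2,3) by (simp add: barycentre_def)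

lemma alpha_dirac: "x \<in> topspace X \<Longrightarrow> \<alpha> (dirac X x) = x"
  by (intro alpha_eqI continuous_valuation_dirac) (simp_all add: val_integral_dirac)

lemma alpha_zero: "\<alpha> (val_zero X) = zero"
  by (intro alpha_eqI continuous_valuation_zero zero_closed)
     (simp add: val_integral_val_zero linear_functional_zero)

lemma alpha_add:
  assumes "continuous_valuation X \<mu>" "continuous_valuation X \<nu>"
  shows "\<alpha> (val_add X \<mu> \<nu>) = add (\<alpha> \<mu>) (\<alpha> \<nu>)"
  using assms
  by (intro alpha_eqI continuous_valuation_add add_closed alpha_closed)
     (simp_all add: val_integral_val_add linear_functional_add alpha_closed functional_alpha)

lemma alpha_scale:
  assumes "continuous_valuation X \<mu>" "0 \<le> r"
  shows "\<alpha> (val_scale X r \<mu>) = scal r (\<alpha> \<mu>)"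
  using assms
  by (intro alpha_eqI continuous_valuation_scale scale_closed alpha_closed)
     (simp_all add: val_integral_val_scale linear_functional_scale alpha_closed functional_alpha)

lemma induced_add_eq: "x \<in> topspace X \<Longrightarrow> y \<in> topspace X \<Longrightarrow> induced_add X \<alpha> x y = add x y"
  by (simp add: induced_add_def alpha_add continuous_valuation_dirac alpha_dirac)

lemma induced_scale_eq: "0 \<le> r \<Longrightarrow> x \<in> topspace X \<Longrightarrow> induced_scale X \<alpha> r x = scal r x"
  by (simp add: induced_scale_def alpha_scale continuous_valuation_dirac alpha_dirac)

text \<open>The right-hand side is a barycentre of \<open>Vw_mult X \<omega>\<close>: change of
  variables turns its value under \<open>\<Lambda>\<close> into the integral of
  \<open>\<Lambda> (\<alpha> \<mu>)\<close>, the barycentre property into an iterated integral, and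
  the exchange of integrals into one against \<open>Vw_mult X \<omega>\<close>.\<close>

lemma alpha_Vw_mult:
  assumes \<omega>: "continuous_valuation (Vw X) \<omega>"
  shows "\<alpha> (Vw_mult X \<omega>) = \<alpha> (Vw_map (Vw X) X \<alpha> \<omega>)"
proof (rule alpha_eqI)
  show "continuous_valuation X (Vw_mult X \<omega>)" using \<omega> by (rule continuous_valuation_Vw_mult)
  have cv: "continuous_valuation X (Vw_map (Vw X) X \<alpha> \<omega>)"
    using continuous_alpha \<omega> by (rule continuous_valuation_Vw_map)
  then show "\<alpha> (Vw_map (Vw X) X \<alpha> \<omega>) \<in> topspace X" by (rule alpha_closed)
  fix \<Lambda> assume L: "linear_functional_on (topspace X) add scal \<Lambda>" "lsc X \<Lambda>"
  have "\<Lambda> (\<alpha> (Vw_map (Vw X) X \<alpha> \<omega>)) = val_integral (Vw X) (\<lambda>\<mu>. \<Lambda> (\<alpha> \<mu>)) \<omega>"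
    using L by (simp add: functional_alpha[OF cv] val_integral_Vw_map[OF continuous_alpha])
  also have "\<dots> = val_integral (Vw X) (val_integral X \<Lambda>) \<omega>"
    using L by (intro val_integral_cong[OF \<omega>]) (simp add: functional_alpha)
  also have "\<dots> = val_integral X \<Lambda> (Vw_mult X \<omega>)"
    using \<omega> L(2) by (rule val_integral_Vw_mult[symmetric])
  finally show "\<Lambda> (\<alpha> (Vw_map (Vw X) X \<alpha> \<omega>)) = val_integral X \<Lambda> (Vw_mult X \<omega>)" .
qed

lemma Vw_algebra_alpha: "Vw_algebra X \<alpha>"
  by (simp add: Vw_algebra_def t0 continuous_alpha alpha_dirac alpha_Vw_mult)

section \<open>Topological consequences of the continuity of \<open>\<alpha>\<close>\<close>

lemma openin_alpha_preimage:
  assumes "openin X U"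
  shows "openin (Vw X) {\<mu>. continuous_valuation X \<mu> \<and> \<alpha> \<mu> \<in> U}"
  using openin_continuous_map_preimage[OF continuous_alpha assms] by simp

lemma sober: "sober_space X"
  unfolding sober_space_def
proof (intro allI impI)
  fix F assume F: "irreducible_closedin X F"
  then have closed: "closedin X F" and sub: "F \<subseteq> topspace X"
    by (auto simp: irreducible_closedin_def dest: closedin_subset)
  have cv: "continuous_valuation X (meets_valuation X F)"
    using F by (rule continuous_valuation_meets)
  define x where "x = \<alpha> (meets_valuation X F)"
  have x: "x \<in> topspace X" using cv by (simp add: x_def alpha_closed)
  \<comment> \<open>Otherwise a basic neighbourhood of the valuation is sent into the complement of
    \<open>F\<close>; by irreducibility it contains the Dirac valuation of some \<open>y\<close> in
    \<open>F\<close>, which is sent to \<open>y\<close>.\<close>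
  have "x \<in> F"
  proof (rule ccontr)
    assume "x \<notin> F"
    let ?W = "{\<mu>. continuous_valuation X \<mu> \<and> \<alpha> \<mu> \<in> topspace X - F}"
    have "openin (Vw X) ?W" using closed by (intro openin_alpha_preimage) auto
    moreover have "meets_valuation X F \<in> ?W" using cv x \<open>x \<notin> F\<close> by (simp add: x_def)
    ultimately obtain K where "finite K"
      and K: "\<And>U r. (U, r) \<in> K \<Longrightarrow> openin X U \<and> 0 \<le> r \<and> ennreal r < meets_valuation X F U"
      and sub_W: "\<And>\<nu>. continuous_valuation X \<nu> \<Longrightarrow> (\<And>U r. (U, r) \<in> K \<Longrightarrow> ennreal r < \<nu> U) \<Longrightarrow> \<nu> \<in> ?W"
      by (rule openin_Vw_basic_nbhd) blast
    \<comment> \<open>The valuation takes only the values 0 and 1, so exceeding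
      \<open>ennreal r\<close> forces the value 1 and \<open>ennreal r < 1\<close>.\<close>
    have meets: "U \<inter> F \<noteq> {}" "ennreal r < 1" if "(U, r) \<in> K" for U r
      using K[OF that] by (auto simp: meets_valuation_def split: if_splits)
    obtain y where y: "y \<in> F" "\<forall>k\<in>K. y \<in> fst k"
      using irreducible_closedin_finite_Int[OF F \<open>finite K\<close>, of fst] K meets(1) by (metis prod.collapse)
    have "dirac X y \<in> ?W"
    proof (rule sub_W)
      fix U r assume "(U, r) \<in> K"
      moreover from this have "y \<in> U" using y(2) by force
      ultimately show "ennreal r < dirac X y U" using K[of U r] meets(2)[of U r] by (simp add: dirac_def)
    qed (rule continuous_valuation_dirac)
    then show False using y(1) sub alpha_dirac by auto
  qed
  have "F = X closure_of {x}"
  proof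
    show "X closure_of {x} \<subseteq> F" using \<open>x \<in> F\<close> closed by (intro closure_of_minimal) auto
    show "F \<subseteq> X closure_of {x}"
    proof
      fix y assume y: "y \<in> F"
      have "x \<in> V" if V: "openin X V" "y \<in> V" for V
      proof -
        \<comment> \<open>For \<open>y\<close> in \<open>F\<close> the Dirac valuation at
          \<open>y\<close> lies below \<open>meets_valuation X F\<close>, and weakly open sets are
          upward closed; so every open set containing \<open>y\<close> contains
          \<open>x\<close>.\<close>
        have "dirac X y \<in> {\<mu>. continuous_valuation X \<mu> \<and> \<alpha> \<mu> \<in> V}"
          using y sub V(2) by (auto simp: continuous_valuation_dirac alpha_dirac subset_iff)
        then have "meets_valuation X F \<in> {\<mu>. continuous_valuation X \<mu> \<and> \<alpha> \<mu> \<in> V}"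
          using cv
          by (rule openin_Vw_upward_closed[OF openin_alpha_preimage[OF V(1)]])
             (use y in \<open>auto simp: dirac_def meets_valuation_def\<close>)
        then show ?thesis by (simp add: x_def)
      qed
      then show "y \<in> X closure_of {x}" using y sub by (auto simp: in_closure_of)
    qed
  qed
  \<comment> \<open>Uniqueness is the T0 property: points with equal closures coincide.\<close>
  then show "\<exists>!x. x \<in> topspace X \<and> F = X closure_of {x}"
    using x t0 unfolding t0_space_closure_of_sing by (intro ex1I[of _ x]) blast+
qed

lemma weakly_locally_convex: "weakly_locally_convex X add scal"
  unfolding weakly_locally_convex_def
proof (intro allI impI)
  fix x U assume U: "openin X U" "x \<in> U"
  then have "x \<in> topspace X" using openin_subset by blast
  then have "dirac X x \<in> {\<mu>. continuous_valuation X \<mu> \<and> \<alpha> \<mu> \<in> U}"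
    using U by (simp add: continuous_valuation_dirac alpha_dirac)
  with openin_alpha_preimage[OF U(1)] obtain K where "finite K"
    and K: "\<And>V r. (V, r) \<in> K \<Longrightarrow> openin X V \<and> 0 \<le> r \<and> ennreal r < dirac X x V"
    and sub: "\<And>\<nu>. continuous_valuation X \<nu> \<Longrightarrow> (\<And>V r. (V, r) \<in> K \<Longrightarrow> ennreal r < \<nu> V) \<Longrightarrow>
      \<nu> \<in> {\<mu>. continuous_valuation X \<mu> \<and> \<alpha> \<mu> \<in> U}"
    by (rule openin_Vw_basic_nbhd) blast
  \<comment> \<open>\<open>B\<close> is convex since its constraints bound evaluations from below
    and evaluations are linear in the valuation; \<open>\<alpha>\<close> preserves convex
    combinations.\<close>
  define B where "B = {\<nu>. continuous_valuation X \<nu> \<and> (\<forall>(V, r)\<in>K. ennreal r < \<nu> V)}"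
  have BU: "\<alpha> \<nu> \<in> U" if "\<nu> \<in> B" for \<nu>
    using sub[of \<nu>] that by (auto simp: B_def)
  have "cone_convex add scal (\<alpha> ` B)"
    unfolding cone_convex_def
  proof (intro ballI)
    fix a b and t :: real assume "a \<in> \<alpha> ` B" "b \<in> \<alpha> ` B" and t: "t \<in> {0..1}"
    then obtain \<mu> \<nu> where \<mu>: "\<mu> \<in> B" "a = \<alpha> \<mu>" and \<nu>: "\<nu> \<in> B" "b = \<alpha> \<nu>" by blast
    define \<kappa> where "\<kappa> = val_add X (val_scale X t \<mu>) (val_scale X (1 - t) \<nu>)"
    have cv: "continuous_valuation X \<mu>" "continuous_valuation X \<nu>"
      using \<mu> \<nu> by (auto simp: B_def)
    have "ennreal r < \<kappa> V" if Vr: "(V, r) \<in> K" for V r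
    proof -
      \<comment> \<open>The minimum of the two masses is a common lower bound that still exceeds
        \<open>r\<close>, and a convex combination of \<open>c\<close> with itself is
        \<open>c\<close>.\<close>
      obtain c where c: "ennreal r < c" "c \<le> \<mu> V" "c \<le> \<nu> V"
        using \<mu>(1) \<nu>(1) Vr by (intro that[of "min (\<mu> V) (\<nu> V)"]) (auto simp: B_def)
      have "c = ennreal t * c + ennreal (1 - t) * c"
        using t by (simp flip: distrib_right ennreal_plus)
      also have "\<dots> \<le> \<kappa> V"
        using K[OF Vr] c by (auto simp: \<kappa>_def val_add_def val_scale_def intro!: add_mono mult_left_mono)
      finally show ?thesis using c(1) by simp
    qed
    then have "\<kappa> \<in> B"
      using cv by (auto simp: B_def \<kappa>_def intro!: continuous_valuation_add continuous_valuation_scale)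
    moreover have "\<alpha> \<kappa> = add (scal t a) (scal (1 - t) b)"
      using cv t \<mu>(2) \<nu>(2) by (simp add: \<kappa>_def alpha_add alpha_scale continuous_valuation_scale)
    ultimately show "add (scal t a) (scal (1 - t) b) \<in> \<alpha> ` B" by (metis imageI)
  qed
  moreover have "x \<in> X interior_of (\<alpha> ` B)"
  proof -
    \<comment> \<open>\<open>O'\<close> consists of the points of the space whose Dirac valuation
      lies in \<open>B\<close>, as all \<open>r\<close> are below 1. It is contained in the image of
      \<open>B\<close> because \<open>\<alpha>\<close> sends each Dirac valuation back to its
      point.\<close>
    define O' where "O' = topspace X \<inter> (\<Inter>(V, r)\<in>K. V)"
    have in_V: "x \<in> V" "ennreal r < 1" if "(V, r) \<in> K" for V r
      using K[OF that] by (auto simp: dirac_def split: if_splits)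
    have "openin X O'"
      using K \<open>finite K\<close> unfolding O'_def by (cases "K = {}") (auto intro!: openin_Int openin_INT2)
    moreover have "x \<in> O'" using in_V \<open>x \<in> topspace X\<close> by (auto simp: O'_def)
    moreover have "O' \<subseteq> \<alpha> ` B"
    proof
      fix y assume y: "y \<in> O'"
      have "ennreal r < dirac X y V" if "(V, r) \<in> K" for V r
        using K[OF that] in_V(2)[OF that] y that by (auto simp: O'_def dirac_def)
      then have "dirac X y \<in> B" by (auto simp: B_def continuous_valuation_dirac)
      moreover have "\<alpha> (dirac X y) = y" using y by (simp add: O'_def alpha_dirac)
      ultimately show "y \<in> \<alpha> ` B" by (metis imageI)
    qed
    ultimately show ?thesis by (auto simp: interior_of_def)
  qed
  ultimately show "\<exists>A. cone_convex add scal A \<and> A \<subseteq> U \<and> x \<in> X interior_of A"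
    using BU by blast
qed

lemma continuous_map_add: "continuous_map (prod_topology X X) X (\<lambda>(x, y). add x y)"
proof -
  have fst: "continuous_map (prod_topology X X) X fst" and snd: "continuous_map (prod_topology X X) X snd"
    by (rule continuous_map_fst continuous_map_snd)+
  have "continuous_map (prod_topology X X) (Vw X) (\<lambda>p. val_add X (dirac X (fst p)) (dirac X (snd p)))"
  proof (rule continuous_map_Vw)
    fix U assume U: "openin X U"
    define P where "P \<pi> = {p \<in> topspace (prod_topology X X). \<pi> p \<in> U}" for \<pi> :: "'a \<times> 'a \<Rightarrow> 'a"
    have "openin (prod_topology X X) (P fst)" "openin (prod_topology X X) (P snd)"
      unfolding P_def using fst snd U by (blast intro: openin_continuous_map_preimage)+
    \<comment> \<open>The mass of \<open>U\<close> under the sum of the two Dirac valuations is the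
      sum of the indicators of two open cylinders.\<close>
    then have "lsc (prod_topology X X) (\<lambda>p. 0 + ennreal 1 * indicator (P fst) p + ennreal 1 * indicator (P snd) p)"
      by (intro lsc_add_indicator lsc_zero) auto
    then show "lsc (prod_topology X X) (\<lambda>p. val_add X (dirac X (fst p)) (dirac X (snd p)) U)"
      by (rule continuous_map_eq) (auto simp: val_add_def dirac_def P_def U)
  qed (intro continuous_valuation_add continuous_valuation_dirac)
  from continuous_map_compose[OF this continuous_alpha] show ?thesis
    by (rule continuous_map_eq)
       (auto simp: alpha_add continuous_valuation_dirac alpha_dirac)
qed

lemma continuous_map_scale: "continuous_map (prod_topology scott_nnreal X) X (\<lambda>(r, x). scal r x)"
proof -
  have "continuous_map (prod_topology scott_nnreal X) (Vw X) (\<lambda>p. val_scale X (fst p) (dirac X (snd p)))"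
  proof (rule continuous_map_Vw)
    fix U assume U: "openin X U"
    \<comment> \<open>For \<open>s\<close> at least 0, the mass exceeds \<open>s\<close> only if
      \<open>x\<close> lies in \<open>U\<close> and \<open>r > s\<close>. The level set is thus a
      rectangle of open sets, which gives joint continuity.\<close>
    have "level (prod_topology scott_nnreal X) (\<lambda>p. val_scale X (fst p) (dirac X (snd p)) U) s = {s<..} \<times> U"
      if "0 \<le> s" for s
      using U that openin_subset[OF U]
      by (auto simp: level_def val_scale_def dirac_def ennreal_less_iff split: if_splits)
    moreover have "openin (prod_topology scott_nnreal X) ({s<..} \<times> U)" if "0 \<le> s" for s
      using U that by (auto simp: openin_prod_Times_iff openin_scott_nnreal)
    ultimately show "lsc (prod_topology scott_nnreal X) (\<lambda>p. val_scale X (fst p) (dirac X (snd p)) U)"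
      by (simp add: lsc_iff)
  qed (intro continuous_valuation_scale continuous_valuation_dirac)
  from continuous_map_compose[OF this continuous_alpha] show ?thesis
    by (rule continuous_map_eq)
       (auto simp: alpha_scale continuous_valuation_dirac alpha_dirac)
qed

lemma topological_cone: "topological_cone X add zero scal"
  by unfold_locales (fact t0 continuous_map_add continuous_map_scale)+

end

theorem proposition4p10:
  fixes X :: "'a topology"
    and add :: "'a \<Rightarrow> 'a \<Rightarrow> 'a"
    and zero :: 'a
    and scal :: "real \<Rightarrow> 'a \<Rightarrow> 'a"
    and \<alpha> :: "('a set \<Rightarrow> ennreal) \<Rightarrow> 'a"
  assumes "semitopological_cone X add zero scal"
    and "continuous_map (Vw X) X \<alpha>"
    and "\<And>\<nu>. \<nu> \<in> topspace (Vw X) \<Longrightarrow>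
           barycentre X add scal \<nu> (\<alpha> \<nu>) \<and>
           (\<forall>b. barycentre X add scal \<nu> b \<longrightarrow> b = \<alpha> \<nu>)"
  shows "Vw_algebra X \<alpha> \<and>
    (\<forall>x\<in>topspace X. \<forall>y\<in>topspace X. induced_add X \<alpha> x y = add x y) \<and>
    (\<forall>r\<ge>0. \<forall>x\<in>topspace X. induced_scale X \<alpha> r x = scal r x) \<and>
    induced_zero X \<alpha> = zero \<and>
    sober_space X \<and>
    weakly_locally_convex X add scal \<and>
    topological_cone X add zero scal"
proof -
  interpret semitopological_cone X add zero scal by fact
  interpret barycentric_cone X add zero scal \<alpha>
    by unfold_locales (use assms(2,3) in auto)
  show ?thesis
    using Vw_algebra_alpha induced_add_eq induced_scale_eq alpha_zero sober weakly_locally_convex topological_cone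
    by (simp add: induced_zero_def)
qed

end
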